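(* Let $k\in\{2,3\}$. Every hypertree is $k$-cordial.
   Context: A hypergraph $H=(V,E)$ consists of a finite vertex set $V$ and a set $E$ of subsets of $V$ (edges), each of cardinality at least $2$. The incidence graph $G_H$ is the bipartite graph on $V\cup E$ with $v$ adjacent to $e$ iff $v\in e$. A hypertree is a hypergraph whose incidence graph $G_H$ is a tree. For a vertex labeling $f:V\to\mathbb{Z}_k$, the induced edge labeling is $f(e)=\sum_{v\in e}f(v)$ (mod $k$). Let $n_a(f)$ and $m_a(f)$ denote the number of vertices, respectively edges, with label $a$. The labeling $f$ is $k$-cordial if $|n_a(f)-n_b(f)|\le 1$ and $|m_a(f)-m_b(f)|\le 1$ for all $a,b\in\mathbb{Z}_k$; $H$ is $k$-cordial if it admits a $k$-cordial labeling. *)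

theory Defs
  imports "Graph_Theory.Digraph_Component"
begin

definition hypergraph :: "'a set \<Rightarrow> 'a set set \<Rightarrow> bool" where
  "hypergraph V E \<longleftrightarrow> finite V \<and> (\<forall>e\<in>E. e \<subseteq> V \<and> 2 \<le> card e)"

text \<open>
  The bipartite graph on the disjoint union of \<open>V\<close> and \<open>E\<close>, represented as a symmetric digraph.
\<close>
definition incidence_graph ::
    "'a set \<Rightarrow> 'a set set \<Rightarrow> ('a + 'a set, ('a + 'a set) \<times> ('a + 'a set)) pre_digraph" where
  "incidence_graph V E =
     \<lparr>verts = Inl ` V \<union> Inr ` E,
      arcs = {(Inl v, Inr e) | v e. v \<in> V \<and> e \<in> E \<and> v \<in> e} \<union>
             {(Inr e, Inl v) | v e. v \<in> V \<and> e \<in> E \<and> v \<in> e},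
      tail = fst, head = snd\<rparr>"

text \<open>
  The library constants \<open>forest\<close> and \<open>tree\<close> count the closed walk \<open>u, v, u\<close> in a symmetric digraph
  as a cycle, so that no undirected graph with an edge is a \<open>tree\<close> in that sense. The cycles of an
  undirected simple graph are the directed cycles of length at least 3 in its symmetric digraph.
\<close>
definition undirected_tree :: "('a, 'b) pre_digraph \<Rightarrow> bool" where
  "undirected_tree G \<longleftrightarrow>
     graph G \<and> connected G \<and> \<not> (\<exists>p. pre_digraph.cycle G p \<and> 3 \<le> length p)"

definition hypertree :: "'a set \<Rightarrow> 'a set set \<Rightarrow> bool" where
  "hypertree V E \<longleftrightarrow> hypergraph V E \<and> undirected_tree (incidence_graph V E)"

text \<open>Elements of \<open>\<int>\<^sub>k\<close> are represented by the residues \<open>0, \<dots>, k - 1\<close>.\<close>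

definition edge_label :: "nat \<Rightarrow> ('a \<Rightarrow> nat) \<Rightarrow> 'a set \<Rightarrow> nat" where
  "edge_label k f e = (\<Sum>v\<in>e. f v) mod k"

definition vertex_count :: "'a set \<Rightarrow> ('a \<Rightarrow> nat) \<Rightarrow> nat \<Rightarrow> nat" where
  "vertex_count V f a = card {v \<in> V. f v = a}"

definition edge_count :: "nat \<Rightarrow> 'a set set \<Rightarrow> ('a \<Rightarrow> nat) \<Rightarrow> nat \<Rightarrow> nat" where
  "edge_count k E f a = card {e \<in> E. edge_label k f e = a}"

definition cordial_labeling :: "nat \<Rightarrow> 'a set \<Rightarrow> 'a set set \<Rightarrow> ('a \<Rightarrow> nat) \<Rightarrow> bool" where
  "cordial_labeling k V E f \<longleftrightarrow>
     (\<forall>v\<in>V. f v < k) \<and>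
     (\<forall>a<k. \<forall>b<k.
        \<bar>int (vertex_count V f a) - int (vertex_count V f b)\<bar> \<le> 1 \<and>
        \<bar>int (edge_count k E f a) - int (edge_count k E f b)\<bar> \<le> 1)"

definition cordial :: "nat \<Rightarrow> 'a set \<Rightarrow> 'a set set \<Rightarrow> bool" where
  "cordial k V E \<longleftrightarrow> (\<exists>f. cordial_labeling k V E f)"

text \<open>The conjunct \<open>graph G\<close> of \<open>undirected_tree\<close> holds for every incidence graph.\<close>

lemma graph_incidence_graph:
  assumes "hypergraph V E"
  shows "graph (incidence_graph V E)"
proof -
  have V: "finite V" and "E \<subseteq> Pow V"
    using assms by (auto simp: hypergraph_def)
  then have E: "finite E"
    by (meson finite_Pow_iff finite_subset)
  let ?U = "Inl ` V \<union> Inr ` E :: ('a + 'a set) set"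
  have "arcs (incidence_graph V E) \<subseteq> ?U \<times> ?U"
    by (auto simp: incidence_graph_def)
  then have A: "finite (arcs (incidence_graph V E))"
    using V E by (meson finite_SigmaI finite_UnI finite_imageI finite_subset)
  show ?thesis
  proof
    show "finite (verts (incidence_graph V E))"
      using V E by (simp add: incidence_graph_def)
    show "finite (arcs (incidence_graph V E))"
      by (fact A)
    show "symmetric (incidence_graph V E)"
      by (auto simp: symmetric_def arcs_ends_conv incidence_graph_def image_Un intro!: symI)
  qed (auto simp: incidence_graph_def arc_to_ends_def)
qed

end

theory Submission
  imports Defs "HOL-Library.Multiset"
begin

text \<open>
  The statement is proved in a stronger form by induction on the number of vertices: every edge \<open>e\<close>
  carries an arbitrary constant \<open>c e\<close>, which is added to its label, and the multiset of vertex labels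
  is an arbitrary prescribed balanced multiset. The constants make it possible to delete a vertex
  of degree one from an edge with at least three vertices (fix its label and absorb it into the
  constant), so that all vertices of degree one may be assumed to lie in edges \<open>{q, u}\<close>.
  Rooting the hypertree at such a vertex, let \<open>e\<close> be the edge above a deepest edge, and \<open>p\<close> its
  highest vertex. Every vertex \<open>q \<noteq> p\<close> of \<open>e\<close> then has one or more children, all of them edges \<open>{q, u}\<close>.
  One deletes \<open>k\<close> or \<open>2k\<close> edges, together with a prescribed multiset of labels containing each label
  equally often up to one extra label. The deleted edges must get every label equally often. What
  could prevent this is that the sum of their labels is forced; it becomes adjustable through
  the label of a vertex \<open>q\<close> of degree two or three that is deleted as well, or, if no such vertex is
  deleted, by changing the constant of \<open>e\<close> beforehand. In each of the finitely many
  configurations, it is a finite check that the labels can be completed whatever labels the induction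
  hypothesis has produced on the rest.
\<close>

section \<open>Level functions\<close>

text \<open>Nothing is known about how the induction hypothesis distributes the labels of the
  remaining edges, and among additions of a multiple of k labels only full sets preserve every
  balanced distribution. Adding up the labels of the deleted edges, together with the change of
  \<open>e\<close> if it stays, gives one linear equation. The sum of the labels handed out is known
  and every deleted leaf occurs once, so the equation involves only constants, labels of surviving
  vertices and the new labels \<open>s\<close>, \<open>t\<close> of vertices of \<open>e\<close>. If
  k deleted edges hang from the same vertex, its label enters k times and drops out. The equation
  then has no unknown, and the constant of \<open>e\<close> has to absorb the defect. In the other
  configurations the equation fixes \<open>s\<close>, or \<open>t\<close> in terms of
  \<open>s\<close>. The root has degree one because modulo 3 its edge serves as a filler: a single
  child and \<open>e\<close>, two single children, or two pairs of children and \<open>e\<close>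
  give 2, 2 and 5 edges, and the edge of the root completes them to 3, 3 and 6.\<close>

text \<open>
  The level \<open>d v\<close> is half the distance from the root \<open>r\<close> to \<open>v\<close> in the incidence graph. The existence of
  such a function for every root is an acyclicity condition that survives the deletion of leaves
  without any reasoning about walks.
\<close>
definition levelled :: "'a \<Rightarrow> ('a \<Rightarrow> nat) \<Rightarrow> 'a set \<Rightarrow> 'a set set \<Rightarrow> bool" where
  "levelled r d V E \<longleftrightarrow> d r = 0 \<and> (\<forall>e\<in>E. \<exists>p\<in>e. \<forall>v\<in>e - {p}. d v = Suc (d p)) \<and>
     (\<forall>v\<in>V - {r}. \<exists>!e. e \<in> E \<and> v \<in> e \<and> (\<exists>w\<in>e. d w < d v))"

text \<open>A level function is demanded for every root so that the root can be chosen late, namely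
  as a vertex of degree one.\<close>

definition htree :: "'a set \<Rightarrow> 'a set set \<Rightarrow> bool" where
  "htree V E \<longleftrightarrow> hypergraph V E \<and> V \<noteq> {} \<and> (\<forall>r\<in>V. \<exists>d. levelled r d V E)"

definition pendant :: "'a set set \<Rightarrow> 'a \<Rightarrow> 'a \<Rightarrow> bool" where
  "pendant E q u \<longleftrightarrow> q \<noteq> u \<and> {q, u} \<in> E \<and> (\<forall>x\<in>E. u \<in> x \<longrightarrow> x = {q, u})"

definition normalized :: "'a set set \<Rightarrow> bool" where
  "normalized E \<longleftrightarrow> (\<forall>e\<in>E. \<forall>v\<in>e. (\<forall>x\<in>E. v \<in> x \<longrightarrow> x = e) \<longrightarrow> card e = 2)"

lemma levelled_root: "levelled r d V E \<Longrightarrow> d r = 0"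
  by (simp add: levelled_def)

lemma levelled_top:
  assumes "levelled r d V E" "e \<in> E"
  obtains p where "p \<in> e" "\<And>v. v \<in> e \<Longrightarrow> v \<noteq> p \<Longrightarrow> d v = Suc (d p)"
proof -
  have "\<exists>p\<in>e. \<forall>v\<in>e - {p}. d v = Suc (d p)" using assms by (simp add: levelled_def)
  then show thesis using that by blast
qed

lemma levelled_parent_ex1:
  assumes "levelled r d V E" "v \<in> V" "v \<noteq> r"
  shows "\<exists>!e. e \<in> E \<and> v \<in> e \<and> (\<exists>w\<in>e. d w < d v)"
  using assms by (simp add: levelled_def)

lemma levelled_parent:
  assumes "levelled r d V E" "v \<in> V" "v \<noteq> r"
  obtains e w where "e \<in> E" "v \<in> e" "w \<in> e" "d w < d v"
  using levelled_parent_ex1[OF assms] by blast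

lemma levelled_parent_unique:
  assumes "levelled r d V E" "v \<in> V" "v \<noteq> r"
    and "e \<in> E" "v \<in> e" "w \<in> e" "d w < d v" and "e' \<in> E" "v \<in> e'" "w' \<in> e'" "d w' < d v"
  shows "e = e'"
  using levelled_parent_ex1[OF assms(1-3)] assms(4-) by blast

lemma levelled_zero:
  assumes "levelled r d V E" "v \<in> V" "d v = 0"
  shows "v = r"
  using levelled_parent[OF assms(1,2)] assms(3) by fastforce

lemma htree_finite:
  assumes "htree V E"
  shows "finite V" "finite E"
proof -
  show "finite V" using assms by (simp add: htree_def hypergraph_def)
  moreover have "E \<subseteq> Pow V" using assms by (auto simp: htree_def hypergraph_def)
  ultimately show "finite E" by (meson finite_Pow_iff finite_subset)
qed

lemma htree_edge:
  assumes "htree V E" "e \<in> E"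
  shows "e \<subseteq> V" "2 \<le> card e" "finite e"
  using assms finite_subset by (auto simp: htree_def hypergraph_def)

section \<open>Deleting leaves, leaf edges and single vertices of edges\<close>

lemma htree_remove_leaf_edge:
  assumes H: "htree V E" and e: "e \<in> E" "p \<in> e"
    and only: "\<And>v x. v \<in> e \<Longrightarrow> v \<noteq> p \<Longrightarrow> x \<in> E \<Longrightarrow> v \<in> x \<Longrightarrow> x = e"
  shows "htree (V - (e - {p})) (E - {e})"
proof -
  have eV: "e \<subseteq> V" using htree_edge(1)[OF H e(1)] .
  have "\<exists>d. levelled r d (V - (e - {p})) (E - {e})" if r: "r \<in> V - (e - {p})" for r
  proof -
    obtain d where d: "levelled r d V E" using H r by (auto simp: htree_def)
    obtain t where t: "t \<in> e" "\<And>v. v \<in> e \<Longrightarrow> v \<noteq> t \<Longrightarrow> d v = Suc (d t)"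
      using levelled_top[OF d e(1)] by blast
    have le: "d t \<le> d v" if "v \<in> e" for v using t(2)[OF that] by (cases "v = t") auto
    \<comment> \<open>A top \<open>t\<close> other than \<open>p\<close> is not the root and needs a
      parent edge with a vertex below \<open>t\<close>. By \<open>only\<close> that edge is
      \<open>e\<close>, in which nothing lies below \<open>t\<close>.\<close>
    have "t = p"
    proof (rule ccontr)
      assume "t \<noteq> p"
      moreover obtain x w where "x \<in> E" "t \<in> x" "w \<in> x" "d w < d t"
        using levelled_parent[OF d, of t] t(1) r eV \<open>t \<noteq> p\<close> by blast
      ultimately show False using only[OF t(1)] le by (metis leD)
    qed
    have "\<exists>!x. x \<in> E - {e} \<and> v \<in> x \<and> (\<exists>w\<in>x. d w < d v)" if v: "v \<in> V - (e - {p}) - {r}" for v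
    proof -
      have ex: "\<exists>!x. x \<in> E \<and> v \<in> x \<and> (\<exists>w\<in>x. d w < d v)" using v levelled_parent_ex1[OF d] by simp
      then obtain x where x: "x \<in> E" "v \<in> x" "\<exists>w\<in>x. d w < d v" by blast
      have "x \<noteq> e" using x v le \<open>t = p\<close> by (metis Diff_iff leD singletonI singletonD)
      with x ex show ?thesis by (metis Diff_iff singletonD)
    qed
    with d have "levelled r d (V - (e - {p})) (E - {e})" by (simp add: levelled_def)
    then show ?thesis by blast
  qed
  moreover have "p \<in> V - (e - {p})" using eV e by auto
  moreover have "hypergraph (V - (e - {p})) (E - {e})"
    using H only unfolding htree_def hypergraph_def by blast
  ultimately show ?thesis by (auto simp: htree_def)
qed

lemma htree_remove_pendant:
  assumes "htree V E" "pendant E q u"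
  shows "htree (V - {u}) (E - {{q, u}})"
proof -
  have "{q, u} - {q} = {u}" using assms(2) by (auto simp: pendant_def)
  then show ?thesis
    using htree_remove_leaf_edge[OF assms(1), of "{q, u}" q] assms(2) by (auto simp: pendant_def)
qed

text \<open>The condition \<open>a u \<notin> U\<close> forbids deleting both ends of an edge; hence
  different \<open>u\<close> have different edges, and each \<open>u\<close> is still pendant when
  its turn comes.\<close>

lemma htree_remove_pendants:
  assumes "finite U" and "htree V E" and "\<And>u. u \<in> U \<Longrightarrow> pendant E (a u) u \<and> a u \<notin> U"
  shows "htree (V - U) (E - (\<lambda>u. {a u, u}) ` U)"
  using assms
proof (induction U)
  case (insert w U)
  have IH: "htree (V - U) (E - (\<lambda>u. {a u, u}) ` U)" using insert by blast
  have w: "pendant E (a w) w" "a w \<noteq> w" using insert.prems(2)[of w] by auto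
  have "{a w, w} \<noteq> {a u, u}" if u: "u \<in> U" for u
    using insert.prems(2)[of w] insert.prems(2)[of u] insert.hyps u by (auto simp: doubleton_eq_iff)
  then have "{a w, w} \<in> E - (\<lambda>u. {a u, u}) ` U" using w(1) by (auto simp: pendant_def)
  then have "pendant (E - (\<lambda>u. {a u, u}) ` U) (a w) w" using w(1) unfolding pendant_def by (metis DiffD1)
  from htree_remove_pendant[OF IH this] show ?case
    unfolding image_insert Diff_insert[of V w U] Diff_insert[of E "{a w, w}" "(\<lambda>u. {a u, u}) ` U"] .
qed simp

text \<open>For a root other than \<open>u\<close>, the vertex \<open>u\<close> is not the top of
  \<open>e\<close>, so the top survives and the same levels work. The second claim allows
  \<open>e - {u}\<close> to receive a constant of its own. It holds because a vertex of
  \<open>e\<close> other than \<open>u\<close> and the top would otherwise have the two parent edges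
  \<open>e\<close> and \<open>e - {u}\<close>.\<close>

lemma htree_remove_vertex:
  assumes H: "htree V E" and e: "e \<in> E" "u \<in> e" "3 \<le> card e"
    and only: "\<And>x. x \<in> E \<Longrightarrow> u \<in> x \<Longrightarrow> x = e"
  shows "htree (V - {u}) (insert (e - {u}) (E - {e}))" "e - {u} \<notin> E"
proof -
  let ?E = "insert (e - {u}) (E - {e})"
  have fe: "finite e" "e \<subseteq> V" using htree_edge[OF H e(1)] by auto
  have c: "2 \<le> card (e - {u})" using e fe by simp
  have top: "\<exists>p\<in>e - {u}. \<forall>v\<in>e - {p}. d v = Suc (d p)" if d: "levelled r d V E" and r: "r \<in> V - {u}" for r d
  proof -
    obtain p where p: "p \<in> e" "\<And>v. v \<in> e \<Longrightarrow> v \<noteq> p \<Longrightarrow> d v = Suc (d p)"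
      using levelled_top[OF d e(1)] by blast
    obtain e' w where "e' \<in> E" "u \<in> e'" "w \<in> e'" "d w < d u"
      using levelled_parent[OF d, of u] r e fe by blast
    with only have "w \<in> e" "d w < d u" by auto
    with p have "p \<noteq> u" by (metis Suc_lessD less_not_refl)
    with p show ?thesis by auto
  qed
  have ne: "V - {u} \<noteq> {}" using c fe by (metis Diff_mono card.empty not_numeral_le_zero subset_empty subset_refl)
  have lev: "levelled r d (V - {u}) ?E" if d: "levelled r d V E" and r: "r \<in> V - {u}" for r d
  proof -
    obtain p where p: "p \<in> e" "p \<noteq> u" "\<And>v. v \<in> e \<Longrightarrow> v \<noteq> p \<Longrightarrow> d v = Suc (d p)"
      using top[OF d r] by blast
    have "\<exists>!x. x \<in> ?E \<and> v \<in> x \<and> (\<exists>w\<in>x. d w < d v)" if v: "v \<in> V - {u} - {r}" for v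
    proof -
      have ex: "\<exists>!x. x \<in> E \<and> v \<in> x \<and> (\<exists>w\<in>x. d w < d v)" using v d by (simp add: levelled_def)
      have eq: "v \<in> e - {u} \<and> (\<exists>w\<in>e - {u}. d w < d v) \<longleftrightarrow> v \<in> e \<and> (\<exists>w\<in>e. d w < d v)"
        using v p by (metis DiffD1 DiffD2 DiffI Suc_lessD lessI less_irrefl_nat singletonD)
      obtain x where x: "x \<in> E" "v \<in> x" "\<exists>w\<in>x. d w < d v"
        and un: "\<And>y. y \<in> E \<Longrightarrow> v \<in> y \<Longrightarrow> \<exists>w\<in>y. d w < d v \<Longrightarrow> y = x" using ex by blast
      show ?thesis
      proof (cases "x = e")
        case True
        then show ?thesis using x eq un by (intro ex1I[of _ "e - {u}"]) (blast+)
      next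
        case False
        then show ?thesis using x eq un e by (intro ex1I[of _ x]) (blast+)
      qed
    qed
    moreover have "\<forall>x\<in>?E. \<exists>p\<in>x. \<forall>v\<in>x - {p}. d v = Suc (d p)"
      using d p unfolding levelled_def by auto
    ultimately show ?thesis using levelled_root[OF d] by (simp add: levelled_def)
  qed
  have "hypergraph (V - {u}) ?E"
    using H c fe only unfolding htree_def hypergraph_def by blast
  then show "htree (V - {u}) ?E"
    using lev H ne unfolding htree_def by (metis DiffD1)
  show "e - {u} \<notin> E"
  proof
    assume x: "e - {u} \<in> E"
    obtain r where r: "r \<in> V - {u}" using ne by blast
    then obtain d where d: "levelled r d V E" using H by (auto simp: htree_def)
    obtain p where p: "p \<in> e" "p \<noteq> u" "\<And>v. v \<in> e \<Longrightarrow> v \<noteq> p \<Longrightarrow> d v = Suc (d p)"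
      using top[OF d r] by blast
    have "card (e - {u} - {p}) \<noteq> 0" using c p fe by simp
    then obtain v where v: "v \<in> e" "v \<noteq> u" "v \<noteq> p" by (metis DiffE card.empty equals0I singletonI)
    then have dv: "d v = Suc (d p)" using p by auto
    then have "v \<noteq> r" using levelled_root[OF d] by auto
    then have "e = e - {u}"
      using levelled_parent_unique[OF d _ _ e(1) v(1) p(1) _ x, of p] v dv p fe by auto
    then show False using e by blast
  qed
qed

text \<open>An edge through \<open>u\<close> cannot have \<open>u\<close> as its top, since its
  other vertices would be deeper. So it is a parent edge of \<open>u\<close>, and there is only
  one.\<close>

lemma deepest_vertex:
  assumes H: "htree V E" and d: "levelled r d V E" and u: "u \<in> V" "u \<noteq> r" "\<And>v. v \<in> V \<Longrightarrow> d v \<le> d u"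
  obtains x q where "x \<in> E" "u \<in> x" "q \<in> x" "d u = Suc (d q)" "\<And>y. y \<in> E \<Longrightarrow> u \<in> y \<Longrightarrow> y = x"
proof -
  obtain x w where x: "x \<in> E" "u \<in> x" "w \<in> x" "d w < d u" using levelled_parent[OF d u(1,2)] by blast
  have low: "\<exists>w\<in>y. d u = Suc (d w)" if y: "y \<in> E" "u \<in> y" for y
  proof -
    obtain p where p: "p \<in> y" "\<And>v. v \<in> y \<Longrightarrow> v \<noteq> p \<Longrightarrow> d v = Suc (d p)"
      using levelled_top[OF d y(1)] by blast
    have "card (y - {u}) \<noteq> 0" using htree_edge[OF H y(1)] y by simp
    then obtain v where v: "v \<in> y" "v \<noteq> u" by (metis DiffE card.empty equals0I singletonI)
    then have "d v \<le> d u" using u htree_edge(1)[OF H y(1)] by auto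
    with v p have "u \<noteq> p" by fastforce
    with p y show ?thesis by auto
  qed
  have "y = x" if y: "y \<in> E" "u \<in> y" for y
    using levelled_parent_unique[OF d u(1,2) y] low[OF y] x by (metis lessI)
  with low[OF x(1,2)] x that show thesis by blast
qed

lemma htree_leaf:
  assumes H: "htree V E" and E: "E \<noteq> {}"
  obtains x u where "x \<in> E" "u \<in> x" "\<And>y. y \<in> E \<Longrightarrow> u \<in> y \<Longrightarrow> y = x"
proof -
  obtain r where r: "r \<in> V" using H by (auto simp: htree_def)
  then obtain d where d: "levelled r d V E" using H by (auto simp: htree_def)
  have fin: "finite (d ` V)" using htree_finite[OF H] by simp
  obtain u where u: "u \<in> V" "d u = Max (d ` V)"
    using Max_in[OF fin] r by (metis (no_types, lifting) empty_iff image_iff image_eqI)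
  have le: "d v \<le> d u" if "v \<in> V" for v using u fin that by simp
  obtain e where e: "e \<in> E" using E by blast
  have "u \<noteq> r"
  proof
    assume "u = r"
    then have "v = r" if "v \<in> V" for v using le[OF that] levelled_root[OF d] levelled_zero[OF d that] by simp
    then have "e \<subseteq> {r}" using htree_edge(1)[OF H e] by blast
    then show False using htree_edge(2)[OF H e] by (metis card_mono card_1_singleton_iff finite.emptyI finite_insert is_singletonI is_singleton_altdef not_numeral_le_zero numeral_le_one_iff order_trans semiring_norm(69))
  qed
  from deepest_vertex[OF H d u(1) this le] that show thesis by metis
qed

lemma normalized_pendant:
  assumes H: "htree V E" and "normalized E" "x \<in> E" "u \<in> x" "\<And>y. y \<in> E \<Longrightarrow> u \<in> y \<Longrightarrow> y = x" "q \<in> x" "q \<noteq> u"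
  shows "pendant E q u \<and> x = {q, u}"
proof -
  have "card x = 2" using assms unfolding normalized_def by blast
  then have x: "x = {q, u}" using assms(4,6,7) by (auto simp: card_2_iff)
  with assms(3,5,7) show ?thesis unfolding pendant_def by blast
qed

lemma normalized_leaf:
  assumes H: "htree V E" and "normalized E" "E \<noteq> {}"
  obtains q u where "pendant E q u"
proof -
  obtain x u where x: "x \<in> E" "u \<in> x" "\<And>y. y \<in> E \<Longrightarrow> u \<in> y \<Longrightarrow> y = x" using htree_leaf[OF assms(1,3)] by blast
  have "card (x - {u}) \<noteq> 0" using htree_edge[OF H x(1)] x(2) by simp
  then obtain q where "q \<in> x" "q \<noteq> u" by (metis DiffE card.empty equals0I singletonI)
  with normalized_pendant[OF H assms(2) x] that show thesis by blast
qed

text \<open>The edge \<open>{s, r}\<close> of the root is a second place to delete a leaf, away from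
  the children below \<open>e\<close>; \<open>s = p\<close> remains possible. It coincides with
  \<open>e\<close> only if \<open>p = r\<close>. In that case no vertex has level above 2, and all
  edges pass through the neighbour of the root.\<close>

lemma normalized_structure:
  assumes H: "htree V E" and N: "normalized E" and m: "2 \<le> card E"
  obtains e p r s where "e \<in> E" "p \<in> e" "pendant E s r" "r \<notin> e - {p}"
    "p \<noteq> r \<Longrightarrow> s \<notin> e - {p}" "p \<noteq> r \<Longrightarrow> {s, r} \<noteq> e"
    "\<And>q. q \<in> e - {p} \<Longrightarrow> \<exists>u. pendant E q u \<and> {q, u} \<noteq> e"
    "\<And>q x. q \<in> e - {p} \<Longrightarrow> x \<in> E \<Longrightarrow> q \<in> x \<Longrightarrow> x \<noteq> e \<Longrightarrow> \<exists>u. pendant E q u \<and> x = {q, u}"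
    "p = r \<Longrightarrow> \<exists>q. e = {p, q} \<and> (\<forall>x\<in>E. q \<in> x)"
proof -
  have "E \<noteq> {}" using m by auto
  then obtain s r where sr: "pendant E s r" using normalized_leaf[OF H N] by blast
  then have sr': "s \<noteq> r" "{s, r} \<in> E" "\<And>x. x \<in> E \<Longrightarrow> r \<in> x \<Longrightarrow> x = {s, r}" by (auto simp: pendant_def)
  have rV: "r \<in> V" "s \<in> V" using htree_edge(1)[OF H sr'(2)] by auto
  then obtain d where d: "levelled r d V E" using H by (auto simp: htree_def)
  have d0: "d r = 0" using levelled_root[OF d] .
  have fin: "finite (d ` V)" using htree_finite[OF H] by simp
  obtain u where u: "u \<in> V" "d u = Max (d ` V)"
    using Max_in[OF fin] rV by (metis (no_types, lifting) empty_iff image_iff image_eqI)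
  have le: "d v \<le> d u" if "v \<in> V" for v using u fin that by simp
  have "d s \<noteq> 0" using levelled_zero[OF d rV(2)] sr' by auto
  then have "u \<noteq> r" using le[OF rV(2)] d0 by auto
  then obtain x q where x: "x \<in> E" "u \<in> x" "q \<in> x" "d u = Suc (d q)" "\<And>y. y \<in> E \<Longrightarrow> u \<in> y \<Longrightarrow> y = x"
    using deepest_vertex[OF H d u(1) _ le] by metis
  have "q \<noteq> u" using x(4) by auto
  then have qu: "pendant E q u" "x = {q, u}" using normalized_pendant[OF H N x(1,2,5,3)] by auto
  have qV: "q \<in> V" using htree_edge(1)[OF H x(1)] x(3) by auto
  have top0: "y = {s, r}" if "y \<in> E" "t \<in> y" "d t = 0" for y t
    using that levelled_zero[OF d, of t] htree_edge(1)[OF H that(1)] sr'(3) by blast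
  \<comment> \<open>With \<open>q = r\<close> the maximal level would be 1, so every edge would have
    its top at level 0, that is at \<open>r\<close>, and \<open>{s, r}\<close> would be the only
    edge.\<close>
  have "q \<noteq> r"
  proof
    assume q: "q = r"
    have "y = {s, r}" if y: "y \<in> E" for y
    proof -
      obtain t where t: "t \<in> y" "\<And>v. v \<in> y \<Longrightarrow> v \<noteq> t \<Longrightarrow> d v = Suc (d t)" using levelled_top[OF d y] by blast
      have "card (y - {t}) \<noteq> 0" using htree_edge[OF H y] t by simp
      then obtain v where "v \<in> y" "v \<noteq> t" by (metis DiffE card.empty equals0I singletonI)
      then have "d t = 0" using t le[of v] x(4) q d0 htree_edge(1)[OF H y] by force
      then show ?thesis using top0 y t by blast
    qed
    then have "E \<subseteq> {{s, r}}" by blast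
    then have "card E \<le> 1" by (metis card.empty card_mono card_insert_disjoint finite.emptyI finite_insert insert_absorb insert_not_empty One_nat_def)
    with m show False by simp
  qed
  then obtain e w where e: "e \<in> E" "q \<in> e" "w \<in> e" "d w < d q" using levelled_parent[OF d qV] by blast
  obtain p where p: "p \<in> e" "\<And>v. v \<in> e \<Longrightarrow> v \<noteq> p \<Longrightarrow> d v = Suc (d p)" using levelled_top[OF d e(1)] by blast
  have qp: "q \<noteq> p" using p(2)[OF e(3)] e(4) by (metis less_not_sym lessI less_irrefl)
  have eV: "e \<subseteq> V" using htree_edge(1)[OF H e(1)] .
  have lev: "d v = d q" "v \<in> V" "v \<noteq> r" if "v \<in> e - {p}" for v
    using that p(2)[of v] p(2)[OF e(2) qp] eV d0 by auto
  \<comment> \<open>The parent edge of \<open>v\<close> is \<open>e\<close>, so \<open>v\<close> is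
    the top of any other edge \<open>y\<close> at \<open>v\<close>. The lower vertices of
    \<open>y\<close> are as deep as \<open>u\<close>, hence of degree one, and normalization makes
    \<open>y\<close> a pair.\<close>
  have child: "\<exists>u. pendant E v u \<and> y = {v, u}" if v: "v \<in> e - {p}" and y: "y \<in> E" "v \<in> y" "y \<noteq> e" for v y
  proof -
    obtain t where t: "t \<in> y" "\<And>v. v \<in> y \<Longrightarrow> v \<noteq> t \<Longrightarrow> d v = Suc (d t)" using levelled_top[OF d y(1)] by blast
    have "d p < d v" using p(2)[of v] v by simp
    then have tv: "t = v" using levelled_parent_unique[OF d lev(2,3)[OF v] y(1,2) t(1) _ e(1) _ p(1)] t(2)[OF y(2)] v y(3)
      by (metis DiffD1 lessI)
    have "card (y - {v}) \<noteq> 0" using htree_edge[OF H y(1)] y by simp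
    then obtain u' where u': "u' \<in> y" "u' \<noteq> v" by (metis DiffE card.empty equals0I singletonI)
    then have "d u' = d u" using t tv lev(1)[OF v] x(4) by simp
    moreover have "u' \<in> V" using htree_edge(1)[OF H y(1)] u' by auto
    moreover have "u' \<noteq> r" using calculation d0 x(4) by auto
    ultimately obtain z where "\<And>y. y \<in> E \<Longrightarrow> u' \<in> y \<Longrightarrow> y = z" using deepest_vertex[OF H d, of u'] le by metis
    then have "\<And>z. z \<in> E \<Longrightarrow> u' \<in> z \<Longrightarrow> z = y" using y u' by metis
    from normalized_pendant[OF H N y(1) u'(1) this y(2)] u' show ?thesis by blast
  qed
  have xe: "x \<noteq> e"
  proof
    assume "x = e"
    then have "u = p \<or> d u = d q" using p(2)[of u] p(2)[OF e(2) qp] x(2) by auto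
    then show False using x(4) p(2)[OF e(2) qp] by auto
  qed
  \<comment> \<open>Without a child, \<open>v\<close> would have degree one. Normalization then
    gives \<open>e = {p, v}\<close>, so \<open>v = q\<close>, but \<open>q\<close> also lies in
    \<open>x\<close>.\<close>
  have ex: "\<exists>u. pendant E v u \<and> {v, u} \<noteq> e" if v: "v \<in> e - {p}" for v
  proof (rule ccontr)
    assume no: "\<not> ?thesis"
    then have only: "y = e" if "y \<in> E" "v \<in> y" for y using child[OF v that] by blast
    then have "card e = 2" using N e(1) v unfolding normalized_def by blast
    then have "v = q" using v p(1) e(2) qp by (auto simp: card_2_iff)
    with only x xe show False by blast
  qed
  have rnot: "r \<notin> e - {p}" using lev by blast
  have d_s: "d s = Suc 0"
    using levelled_top[OF d sr'(2)] d0 sr' by (metis insertCI insertE nat.distinct(1) singletonD)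
  show thesis
  proof (rule that[OF e(1) p(1) sr rnot _ _ ex child])
    assume pr: "p \<noteq> r"
    then show ne: "{s, r} \<noteq> e" using rnot by blast
    show "s \<notin> e - {p}"
    proof
      assume s: "s \<in> e - {p}"
      have "d p < d s" using p(2)[of s] s by simp
      then have "e = {s, r}" using levelled_parent_unique[OF d rV(2) sr'(1) e(1) _ p(1) _ sr'(2), of r] s d_s d0 by auto
      with ne show False by simp
    qed
  next
    assume pr: "p = r"
    then have e_eq: "e = {s, r}" using sr' e p by blast
    have dq: "d q = Suc 0" using p(2)[OF e(2) qp] pr d0 by simp
    have qs: "q = s" using e_eq e(2) qp pr by auto
    have "q \<in> y" if y: "y \<in> E" for y
    proof -
      obtain t where t: "t \<in> y" "\<And>v. v \<in> y \<Longrightarrow> v \<noteq> t \<Longrightarrow> d v = Suc (d t)" using levelled_top[OF d y] by blast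
      have yV: "y \<subseteq> V" using htree_edge(1)[OF H y] .
      have "card (y - {t}) \<noteq> 0" using htree_edge[OF H y] t by simp
      then obtain v where "v \<in> y" "v \<noteq> t" by (metis DiffE card.empty equals0I singletonI)
      then have "d t \<le> 1" using t(2)[of v] le[of v] x(4) dq yV by auto
      then consider "d t = 0" | "d t = 1" by linarith
      then show ?thesis
      proof cases
        case 1
        then show ?thesis using top0[OF y t(1)] qs by simp
      next
        case 2
        then have "t \<noteq> r" using d0 by auto
        then obtain z w where z: "z \<in> E" "t \<in> z" "w \<in> z" "d w < d t" using levelled_parent[OF d, of t] t yV by blast
        then have "z = {s, r}" using top0[of z w] 2 by simp
        then show ?thesis using z \<open>t \<noteq> r\<close> qs t by auto
      qed
    qed
    with e_eq qs pr show "\<exists>q. e = {p, q} \<and> (\<forall>x\<in>E. q \<in> x)" by (metis insert_commute)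
  qed
qed

section \<open>Hypertrees have level functions\<close>

context wf_digraph
begin

lemma awalk_verts_snoc:
  "awalk u p (tail G e) \<Longrightarrow> awalk_verts u (p @ [e]) = awalk_verts u p @ [head G e]"
  by (induction p arbitrary: u) (auto simp: awalk_simps)

lemma awalk_snoc:
  "awalk u p (tail G e) \<Longrightarrow> e \<in> arcs G \<Longrightarrow> awalk u (p @ [e]) (head G e)"
  by (induction p arbitrary: u) (auto simp: awalk_simps)

text \<open>Descend from \<open>a\<close> and \<open>b\<close> in parallel until the two descents
  meet, at the latest in \<open>r\<close>, and glue them. All inner vertices are at lower levels, so
  \<open>a\<close> and \<open>b\<close> are not repeated.\<close>

lemma level_apath:
  assumes sym: "symmetric G"
    and zero: "\<And>x. x \<in> verts G \<Longrightarrow> l x = 0 \<Longrightarrow> x = r"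
    and down: "\<And>x. x \<in> verts G \<Longrightarrow> x \<noteq> r \<Longrightarrow> \<exists>y. x \<rightarrow>\<^bsub>G\<^esub> y \<and> l x = Suc (l y)"
    and root: "l r = 0"
    and ab: "a \<in> verts G" "b \<in> verts G" "a \<noteq> b" "l a = l b"
  shows "\<exists>p. apath a p b \<and> 2 \<le> length p \<and> (\<forall>x\<in>set (awalk_verts a p). l x \<le> l a)"
  using ab
proof (induction "l a" arbitrary: a b)
  case 0
  then show ?case using zero by metis
next
  case (Suc n)
  obtain a' where a': "a \<rightarrow>\<^bsub>G\<^esub> a'" "l a = Suc (l a')" using down Suc root by (metis nat.distinct(1))
  obtain b' where b': "b \<rightarrow>\<^bsub>G\<^esub> b'" "l b = Suc (l b')" using down Suc root by (metis nat.distinct(1))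
  obtain \<alpha> where \<alpha>: "\<alpha> \<in> arcs G" "tail G \<alpha> = a" "head G \<alpha> = a'" using a' by auto
  have "b' \<rightarrow>\<^bsub>G\<^esub> b" using b' sym by (metis symmetric_def symD)
  then obtain \<beta> where \<beta>: "\<beta> \<in> arcs G" "tail G \<beta> = b'" "head G \<beta> = b" by auto
  have in_verts: "a' \<in> verts G" "b' \<in> verts G" using a' b' by auto
  have "\<exists>p. apath a' p b' \<and> (\<forall>x\<in>set (awalk_verts a' p). l x \<le> n)"
  proof (cases "a' = b'")
    case True
    then show ?thesis using in_verts a' Suc by (intro exI[of _ "[]"]) (auto simp: apath_simps)
  next
    case False
    have "n = l a'" "l a' = l b'" using a' b' Suc.hyps(2) Suc.prems(4) by auto
    with Suc.hyps(1)[of a' b'] in_verts False show ?thesis by blast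
  qed
  then obtain p where p: "apath a' p b'" "\<And>x. x \<in> set (awalk_verts a' p) \<Longrightarrow> l x \<le> n" by blast
  then have w: "awalk a' p b'" "distinct (awalk_verts a' p)" by (auto simp: apath_def)
  have v: "awalk_verts a (\<alpha> # p @ [\<beta>]) = a # awalk_verts a' p @ [b]"
    using awalk_verts_snoc[of a' p \<beta>] \<alpha> \<beta> w by simp
  have "awalk a (\<alpha> # p @ [\<beta>]) b"
    using awalk_snoc[of a' p \<beta>] \<alpha> \<beta> w by (auto simp: awalk_Cons_iff)
  moreover have "a \<notin> set (awalk_verts a' p)" "b \<notin> set (awalk_verts a' p)"
    using p(2) Suc by (metis Suc_n_not_le_n)+
  ultimately have "apath a (\<alpha> # p @ [\<beta>]) b" using v w Suc.prems by (auto simp: apath_def)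
  moreover have "\<forall>x\<in>set (awalk_verts a (\<alpha> # p @ [\<beta>])). l x \<le> l a"
    using v p(2) Suc by force
  ultimately show ?case by (intro exI[of _ "\<alpha> # p @ [\<beta>]"]) auto
qed

text \<open>Two distinct vertices of equal level are joined by a path of length at least 2 that
  never rises above them. An arc between them, or two arcs through a common neighbour
  \<open>x\<close> of higher level, would close it to a cycle of length at least 3.\<close>

lemma level_acyclic:
  assumes sym: "symmetric G"
    and zero: "\<And>x. x \<in> verts G \<Longrightarrow> l x = 0 \<Longrightarrow> x = r"
    and down: "\<And>x. x \<in> verts G \<Longrightarrow> x \<noteq> r \<Longrightarrow> \<exists>y. x \<rightarrow>\<^bsub>G\<^esub> y \<and> l x = Suc (l y)"
    and root: "l r = 0"
    and acyclic: "\<not> (\<exists>p. cycle p \<and> 3 \<le> length p)"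
  shows "x \<rightarrow>\<^bsub>G\<^esub> y \<Longrightarrow> x \<noteq> y \<Longrightarrow> l x \<noteq> l y"
    and "x \<rightarrow>\<^bsub>G\<^esub> y \<Longrightarrow> x \<rightarrow>\<^bsub>G\<^esub> z \<Longrightarrow> l y < l x \<Longrightarrow> l z = l y \<Longrightarrow> y = z"
proof -
  note path = level_apath[where l = l, OF sym zero down root]
  have rev: "y \<rightarrow>\<^bsub>G\<^esub> x" if "x \<rightarrow>\<^bsub>G\<^esub> y" for x y using that sym by (metis symmetric_def symD)
  show "l x \<noteq> l y" if xy: "x \<rightarrow>\<^bsub>G\<^esub> y" "x \<noteq> y"
  proof
    assume "l x = l y"
    moreover have "x \<in> verts G" "y \<in> verts G" using xy(1) by auto
    ultimately obtain p where p: "apath x p y" "2 \<le> length p" using path[of x y] xy(2) by blast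
    obtain \<beta> where \<beta>: "\<beta> \<in> arcs G" "tail G \<beta> = y" "head G \<beta> = x" using rev[OF xy(1)] by auto
    have w: "awalk x p y" "distinct (awalk_verts x p)" using p by (auto simp: apath_def)
    obtain vs where vs: "awalk_verts x p = x # vs" using w p by (cases p) (auto simp: awalk_simps)
    have "awalk_verts x (p @ [\<beta>]) = x # vs @ [x]" using awalk_verts_snoc[of x p \<beta>] \<beta> w vs by simp
    then have "cycle (p @ [\<beta>])"
      unfolding cycle_def using awalk_snoc[of x p \<beta>] \<beta> w vs by (intro exI[of _ x]) auto
    then show False using acyclic p by (metis Suc_le_mono eval_nat_numeral(3) length_append_singleton)
  qed
  show "y = z" if xyz: "x \<rightarrow>\<^bsub>G\<^esub> y" "x \<rightarrow>\<^bsub>G\<^esub> z" "l y < l x" "l z = l y"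
  proof (rule ccontr)
    assume "y \<noteq> z"
    moreover have "y \<in> verts G" "z \<in> verts G" using xyz(1,2) by auto
    ultimately obtain p where p: "apath y p z" "2 \<le> length p" "\<forall>v\<in>set (awalk_verts y p). l v \<le> l y"
      using path[of y z] xyz(4) by metis
    obtain \<beta> where \<beta>: "\<beta> \<in> arcs G" "tail G \<beta> = z" "head G \<beta> = x" using rev[OF xyz(2)] by auto
    obtain \<alpha> where \<alpha>: "\<alpha> \<in> arcs G" "tail G \<alpha> = x" "head G \<alpha> = y" using xyz by auto
    have w: "awalk y p z" "distinct (awalk_verts y p)" using p by (auto simp: apath_def)
    have "awalk_verts x (\<alpha> # p @ [\<beta>]) = x # awalk_verts y p @ [x]"
      using awalk_verts_snoc[of y p \<beta>] \<alpha> \<beta> w by simp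
    moreover have "x \<notin> set (awalk_verts y p)" using p xyz by (metis leD)
    ultimately have "cycle (\<alpha> # p @ [\<beta>])"
      unfolding cycle_def using awalk_snoc[of y p \<beta>] \<alpha> \<beta> w
      by (intro exI[of _ x]) (auto simp: awalk_Cons_iff)
    then show False using acyclic p by (metis Suc_le_mono Suc_leD eval_nat_numeral(3) length_append_singleton length_Cons)
  qed
qed

lemma distance_level:
  assumes conn: "\<And>x. x \<in> verts G \<Longrightarrow> r \<rightarrow>\<^sup>*\<^bsub>G\<^esub> x" and sym: "symmetric G"
  obtains l :: "'a \<Rightarrow> nat" where "l r = 0" "\<And>x. x \<in> verts G \<Longrightarrow> l x = 0 \<Longrightarrow> x = r"
    "\<And>x. x \<in> verts G \<Longrightarrow> x \<noteq> r \<Longrightarrow> \<exists>y. x \<rightarrow>\<^bsub>G\<^esub> y \<and> l x = Suc (l y)"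
    "\<And>x y. x \<rightarrow>\<^bsub>G\<^esub> y \<Longrightarrow> l x \<le> Suc (l y)"
proof -
  define l where "l x = (LEAST n. (r, x) \<in> arcs_ends G ^^ n)" for x
  have ex: "\<exists>n. (r, x) \<in> arcs_ends G ^^ n" if "x \<in> verts G" for x
    using conn[OF that] by (metis reachable_rtranclI rtrancl_power)
  have lI: "(r, x) \<in> arcs_ends G ^^ l x" if "x \<in> verts G" for x
    unfolding l_def using ex[OF that] by (rule LeastI_ex)
  have le: "l x \<le> n" if "(r, x) \<in> arcs_ends G ^^ n" for x n unfolding l_def using that by (rule Least_le)
  have rev: "y \<rightarrow>\<^bsub>G\<^esub> x" if "x \<rightarrow>\<^bsub>G\<^esub> y" for x y using that sym by (metis symmetric_def symD)
  have step: "l x \<le> Suc (l y)" if "x \<rightarrow>\<^bsub>G\<^esub> y" for x y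
    using le[OF relpow_Suc_I[OF lI rev[OF that]]] that by auto
  show thesis
  proof (rule that[of l])
    show "l r = 0" using le[of r 0] by simp
    show "x = r" if "x \<in> verts G" "l x = 0" for x using lI[OF that(1)] that(2) by simp
    show "l x \<le> Suc (l y)" if "x \<rightarrow>\<^bsub>G\<^esub> y" for x y using step[OF that] .
    show "\<exists>y. x \<rightarrow>\<^bsub>G\<^esub> y \<and> l x = Suc (l y)" if x: "x \<in> verts G" "x \<noteq> r" for x
    proof -
      obtain n where n: "l x = Suc n" using lI[OF x(1)] x(2) by (cases "l x") auto
      then obtain y where y: "(r, y) \<in> arcs_ends G ^^ n" "y \<rightarrow>\<^bsub>G\<^esub> x" using lI[OF x(1)] by (metis relpow_Suc_E)
      then have "l y \<le> n" using le by blast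
      then show ?thesis using step[OF rev[OF y(2)]] rev[OF y(2)] n by (metis Suc_le_mono le_antisym)
    qed
  qed
qed

end

lemma incidence_dominates:
  "x \<rightarrow>\<^bsub>incidence_graph V E\<^esub> y \<longleftrightarrow>
     (\<exists>v e. v \<in> V \<and> e \<in> E \<and> v \<in> e \<and> (x = Inl v \<and> y = Inr e \<or> x = Inr e \<and> y = Inl v))"
  by (auto simp: incidence_graph_def arcs_ends_conv)

lemma hypertree_imp_htree:
  assumes "hypertree V E"
  shows "htree V E"
proof -
  let ?G = "incidence_graph V E"
  have H: "hypergraph V E" and g: "graph ?G" and c: "connected ?G"
    and ac: "\<not> (\<exists>p. pre_digraph.cycle ?G p \<and> 3 \<le> length p)"
    using assms by (auto simp: hypertree_def undirected_tree_def)
  interpret graph ?G by (rule g)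
  have sym: "symmetric ?G" by (rule sym_arcs)
  have sc: "strongly_connected ?G" using symmetric_connected_imp_strongly_connected[OF sym c] .
  have verts: "verts ?G = Inl ` V \<union> Inr ` E" by (simp add: incidence_graph_def)
  have "\<exists>d. levelled r d V E" if r: "r \<in> V" for r
  proof -
    have "Inl r \<rightarrow>\<^sup>*\<^bsub>?G\<^esub> x" if "x \<in> verts ?G" for x
      using sc that r verts by (auto simp: strongly_connected_def)
    then obtain l where l: "l (Inl r) = 0" "\<And>x. x \<in> verts ?G \<Longrightarrow> l x = 0 \<Longrightarrow> x = Inl r"
      "\<And>x. x \<in> verts ?G \<Longrightarrow> x \<noteq> Inl r \<Longrightarrow> \<exists>y. x \<rightarrow>\<^bsub>?G\<^esub> y \<and> l x = Suc (l y)"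
      "\<And>x y. x \<rightarrow>\<^bsub>?G\<^esub> y \<Longrightarrow> l x \<le> Suc (l y)"
      using distance_level[OF _ sym] by blast
    have acyc1: "l x \<noteq> l y" if "x \<rightarrow>\<^bsub>?G\<^esub> y" "x \<noteq> y" for x y
      by (rule level_acyclic(1)[where l = l, OF sym _ _ l(1) ac]) (use l(2,3) that in auto)
    have acyc2: "y = z" if "x \<rightarrow>\<^bsub>?G\<^esub> y" "x \<rightarrow>\<^bsub>?G\<^esub> z" "l y < l x" "l z = l y" for x y z
      by (rule level_acyclic(2)[where l = l, OF sym _ _ l(1) ac]) (use l(2,3) that in auto)
    \<comment> \<open>The distances of two vertices of an edge differ by 0 or 2, so halving yields
      steps of exactly one, whatever the parity.\<close>
    define d where "d v = l (Inl v) div 2" for v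
    have adj: "Inl v \<rightarrow>\<^bsub>?G\<^esub> Inr e" "Inr e \<rightarrow>\<^bsub>?G\<^esub> Inl v" if "e \<in> E" "v \<in> e" for e v
      using that H by (auto simp: incidence_dominates hypergraph_def)
    have near: "l (Inl v) = Suc (l (Inr e)) \<or> l (Inr e) = Suc (l (Inl v))" if "e \<in> E" "v \<in> e" for e v
      using adj[OF that] l(4)[of "Inl v" "Inr e"] l(4)[of "Inr e" "Inl v"] acyc1[of "Inl v" "Inr e"] by force
    have top: "\<exists>p\<in>e. l (Inr e) = Suc (l (Inl p)) \<and> (\<forall>v\<in>e - {p}. l (Inl v) = Suc (l (Inr e)))" if e: "e \<in> E" for e
    proof -
      obtain y where y: "Inr e \<rightarrow>\<^bsub>?G\<^esub> y" "l (Inr e) = Suc (l y)" using l(3)[of "Inr e"] e verts by auto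
      then obtain p where p: "y = Inl p" "p \<in> e" by (auto simp: incidence_dominates)
      have "l (Inl v) = Suc (l (Inr e))" if v: "v \<in> e - {p}" for v
        using near[OF e, of v] acyc2[of "Inr e" y "Inl v"] y p v adj(2)[OF e, of v] by auto
      with y p show ?thesis by auto
    qed
    have less: "(\<exists>w\<in>e. d w < d v) \<longleftrightarrow> l (Inl v) = Suc (l (Inr e))" if e: "e \<in> E" "v \<in> e" for e v
    proof -
      obtain p where p: "p \<in> e" "l (Inr e) = Suc (l (Inl p))" "\<forall>v\<in>e - {p}. l (Inl v) = Suc (l (Inr e))"
        using top[OF e(1)] by blast
      have dv: "d w = Suc (d p)" if "w \<in> e" "w \<noteq> p" for w using p that by (simp add: d_def)
      show ?thesis
      proof (cases "v = p")
        case True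
        then show ?thesis using p dv by (metis Suc_lessD less_not_refl n_not_Suc_n less_not_sym lessI Suc_n_not_le_n le_refl le_Suc_eq)
      next
        case False
        then show ?thesis using p dv e by (metis DiffI lessI singletonD)
      qed
    qed
    have "levelled r d V E"
      unfolding levelled_def
    proof (intro conjI ballI)
      show "d r = 0" using l by (simp add: d_def)
    next
      fix e assume "e \<in> E"
      then obtain p where "p \<in> e" "l (Inr e) = Suc (l (Inl p))" "\<forall>v\<in>e - {p}. l (Inl v) = Suc (l (Inr e))"
        using top by blast
      then show "\<exists>p\<in>e. \<forall>v\<in>e - {p}. d v = Suc (d p)" by (intro bexI[of _ p]) (auto simp: d_def)
    next
      fix v assume v: "v \<in> V - {r}"
      then obtain y where y: "Inl v \<rightarrow>\<^bsub>?G\<^esub> y" "l (Inl v) = Suc (l y)" using l(3)[of "Inl v"] verts by auto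
      then obtain e where e: "y = Inr e" "e \<in> E" "v \<in> e" by (auto simp: incidence_dominates)
      show "\<exists>!e. e \<in> E \<and> v \<in> e \<and> (\<exists>w\<in>e. d w < d v)"
      proof (rule ex1I[of _ e])
        show "e \<in> E \<and> v \<in> e \<and> (\<exists>w\<in>e. d w < d v)" using e y less by simp
      next
        fix x assume x: "x \<in> E \<and> v \<in> x \<and> (\<exists>w\<in>x. d w < d v)"
        then have "l (Inl v) = Suc (l (Inr x))" using less by blast
        then have "l y < l (Inl v)" "l (Inr x) = l y" using y(2) by simp_all
        then have "y = Inr x" using acyc2[OF y(1) adj(1)[of x v]] x by blast
        then show "x = e" using e(1) by simp
      qed
    qed
    then show ?thesis by blast
  qed
  moreover have "V \<noteq> {}"
  proof
    assume "V = {}"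
    then have "E = {}" using H by (auto simp: hypergraph_def)
    then show False using sc verts \<open>V = {}\<close> by (simp add: strongly_connected_def)
  qed
  ultimately show ?thesis using H by (simp add: htree_def)
qed

section \<open>Balanced labelings with prescribed vertex labels\<close>

definition elabel :: "('a set \<Rightarrow> 'l) \<Rightarrow> ('a \<Rightarrow> 'l) \<Rightarrow> 'a set \<Rightarrow> 'l::ab_group_add" where
  "elabel c f e = c e + sum f e"

definition balanced :: "'l multiset \<Rightarrow> bool" where
  "balanced M \<longleftrightarrow> (\<forall>a b. count M a \<le> Suc (count M b))"

definition solvable :: "'a set \<Rightarrow> 'a set set \<Rightarrow> ('a set \<Rightarrow> 'l) \<Rightarrow> 'l::ab_group_add multiset \<Rightarrow> bool" where
  "solvable V E c M \<longleftrightarrow>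
     (\<exists>f. image_mset f (mset_set V) = M \<and> balanced (image_mset (elabel c f) (mset_set E)))"

section \<open>Splitting and extending balanced multisets\<close>

lemma balanced_add_full:
  fixes M :: "'l::finite multiset"
  shows "balanced (M + mset_set UNIV) \<longleftrightarrow> balanced M"
  by (simp add: balanced_def)

text \<open>A label of maximal count is taken away.\<close>

lemma balanced_remove:
  assumes "balanced M" "M \<noteq> {#}"
  obtains a where "a \<in># M" "balanced (M - {#a#})"
proof -
  have "Max (count M ` set_mset M) \<in> count M ` set_mset M" by (rule Max_in) (use assms(2) in auto)
  then obtain a where a: "a \<in># M" "count M a = Max (count M ` set_mset M)" by auto
  have le: "count M b \<le> count M a" for b
    using a(2) by (cases "b \<in># M") (auto simp: not_in_iff)
  have "count (M - {#a#}) x \<le> Suc (count (M - {#a#}) y)" for x y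
  proof (cases "y = a")
    case True
    have "count M a = Suc (count M a - 1)" using a(1) by simp
    then show ?thesis using True le[of x] by simp
  next
    case False
    have "count (M - {#a#}) x \<le> count M x" by simp
    also have "\<dots> \<le> Suc (count M y)" using assms(1) by (simp add: balanced_def)
    finally show ?thesis using False by simp
  qed
  then have "balanced (M - {#a#})" by (simp add: balanced_def)
  with a that show thesis by blast
qed

lemma balanced_full:
  fixes M :: "'l::finite multiset"
  assumes "balanced M" "card (UNIV :: 'l set) \<le> size M"
  obtains N where "M = N + mset_set UNIV" "balanced N"
proof -
  have sz: "size M = (\<Sum>a\<in>UNIV. count M a)"
    unfolding size_multiset_overloaded_eq by (rule sum.mono_neutral_left) (auto simp: not_in_iff)
  have "count M b \<noteq> 0" for b
  proof
    assume b: "count M b = 0"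
    then have le: "count M a \<le> 1" for a using assms(1) by (metis balanced_def One_nat_def)
    have "size M = (\<Sum>a\<in>UNIV - {b}. count M a)" using sz b by (simp add: sum.remove[of UNIV b])
    also have "\<dots> \<le> (\<Sum>a\<in>UNIV - {b}. 1)" by (rule sum_mono) (rule le)
    finally have "size M \<le> card (UNIV :: 'l set) - 1" by simp
    then show False using assms(2) by (metis One_nat_def diff_less finite_UNIV_card_ge_0 finite_class.finite_UNIV le_trans less_Suc0 not_le)
  qed
  then have "mset_set UNIV \<subseteq># M" by (auto simp: subseteq_mset_def Suc_le_eq)
  then obtain N where "M = N + mset_set UNIV" by (metis subset_mset.diff_add)
  with assms(1) that balanced_add_full show thesis by metis
qed

lemma balanced_divisible:
  fixes M :: "'l::finite multiset"
  assumes "balanced M" "size M = n * card (UNIV :: 'l set)"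
  shows "count M a = count M b"
  using assms
proof (induction n arbitrary: M)
  case (Suc n)
  obtain N where N: "M = N + mset_set UNIV" "balanced N" using balanced_full[OF Suc.prems(1)] Suc.prems(2) by auto
  then show ?case using Suc.IH[of N] Suc.prems by simp
qed simp

text \<open>When the size of \<open>M\<close> is a multiple of the number of labels, all counts in
  \<open>M\<close> agree, so adding \<open>M\<close> does not change the differences between the
  counts of \<open>N\<close>.\<close>

lemma balanced_divisible_add:
  fixes M N :: "'l::finite multiset"
  assumes "balanced M" "card (UNIV :: 'l set) dvd size M" "balanced N"
  shows "balanced (M + N)"
proof -
  obtain n where "size M = n * card (UNIV :: 'l set)" using assms(2) by (metis dvd_def mult.commute)
  then have eq: "count M a = count M b" for a b using balanced_divisible[OF assms(1)] by blast
  have "count (M + N) a \<le> Suc (count (M + N) b)" for a b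
    using assms(3) eq[of a b] by (simp add: balanced_def)
  then show ?thesis by (simp add: balanced_def)
qed

lemma balanced_take_full:
  fixes M :: "'l::finite multiset"
  assumes "balanced M" "n * card (UNIV :: 'l set) \<le> size M"
  obtains N where "M = N + repeat_mset n (mset_set UNIV)" "balanced N"
  using assms
proof (induction n arbitrary: M thesis)
  case (Suc n)
  obtain N where N: "M = N + mset_set UNIV" "balanced N" using balanced_full[OF Suc.prems(2)] Suc.prems(3) by auto
  obtain N' where N': "N = N' + repeat_mset n (mset_set UNIV)" "balanced N'"
    using Suc.IH[of N] N Suc.prems(3) by auto
  show ?case by (rule Suc.prems(1)[of N']) (use N N' in \<open>simp_all add: ac_simps\<close>)
qed simp

lemma balanced_take:
  fixes M :: "'l::finite multiset"
  assumes "mset ts = repeat_mset n (mset_set (UNIV :: 'l set))" "balanced M" "length ts \<le> size M"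
  obtains N where "M = N + mset ts" "balanced N"
proof -
  have "length ts = n * card (UNIV :: 'l set)" using arg_cong[OF assms(1), of size] by simp
  then show thesis using balanced_take_full[OF assms(2), of n] assms(1,3) that by metis
qed

lemma balanced_take_one:
  fixes M :: "'l::finite multiset"
  assumes "mset ts = repeat_mset n (mset_set (UNIV :: 'l set))" "balanced M" "length ts < size M"
  obtains N a where "M = N + mset (ts @ [a])" "balanced N"
proof -
  obtain N where N: "M = N + mset ts" "balanced N" using balanced_take[OF assms(1,2)] assms(3) by auto
  then have "N \<noteq> {#}" using assms(3) by auto
  then obtain a where "a \<in># N" "balanced (N - {#a#})" using balanced_remove[OF N(2)] by blast
  then show thesis using N that[of "N - {#a#}" a] by simp
qed

lemma balanced_single: "balanced {#a#}"
  by (simp add: balanced_def)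

lemma balanced_add:
  fixes M :: "'l::finite multiset"
  assumes "balanced M"
  obtains a where "balanced (add_mset a M)"
proof -
  have "Min (range (count M)) \<in> range (count M)" by (rule Min_in) auto
  then obtain a where a: "count M a = Min (range (count M))" by (metis rangeE)
  have le: "count M a \<le> count M b" for b using a by simp
  have "count (add_mset a M) x \<le> Suc (count (add_mset a M) y)" for x y
    using assms le[of y] le[of x] by (auto simp: balanced_def le_SucI)
  then show thesis using that[of a] unfolding balanced_def by blast
qed

lemma balanced_add_repeat_full:
  fixes M :: "'l::finite multiset"
  shows "balanced (M + repeat_mset n (mset_set UNIV)) \<longleftrightarrow> balanced M"
  by (simp add: balanced_def)

section \<open>Extending a labeling of a smaller hypertree\<close>

lemma mset_set_split:
  assumes "finite V" "A \<subseteq> V"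
  shows "mset_set V = mset_set (V - A) + mset_set A"
proof -
  have "V - A \<union> A = V" "(V - A) \<inter> A = {}" using assms(2) by auto
  moreover have "finite A" using assms finite_subset by blast
  ultimately show ?thesis using mset_set_Union[of "V - A" A] assms(1) by auto
qed

text \<open>
  The part \<open>V - A\<close>, \<open>E - X\<close> is common to the given and to the smaller hypertree; \<open>A\<close> and \<open>X\<close> take the place
  of \<open>A0\<close> and \<open>X0\<close> there.
\<close>
lemma solvable_extend:
  assumes fin: "finite V" "finite E" "finite A0" "finite X0" and sub: "A \<subseteq> V" "X \<subseteq> E"
    and disj: "(V - A) \<inter> A0 = {}" "(E - X) \<inter> X0 = {}"
    and old: "\<And>e. e \<in> E - X \<Longrightarrow> e \<inter> A = {} \<and> c0 e = c e"
    and g: "image_mset g (mset_set (V - A \<union> A0)) = M"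
    and bal: "balanced (image_mset (elabel c0 g) (mset_set (E - X \<union> X0)) + Y)"
    and x: "image_mset f (mset_set A) = image_mset g (mset_set A0) + b"
    and f: "\<And>v. v \<notin> A \<Longrightarrow> f v = g v"
    and lab: "image_mset (elabel c f) (mset_set X) = image_mset (elabel c0 g) (mset_set X0) + Y"
  shows "solvable V E c (M + b)"
proof -
  have finA: "finite A" "finite X" using fin sub finite_subset by auto
  have V: "mset_set V = mset_set (V - A) + mset_set A"
    using mset_set_split fin sub by blast
  have E: "mset_set E = mset_set (E - X) + mset_set X"
    using mset_set_split fin sub by blast
  have V0: "mset_set (V - A \<union> A0) = mset_set (V - A) + mset_set A0" using mset_set_Union[of "V - A" A0] fin disj by simp
  have E0: "mset_set (E - X \<union> X0) = mset_set (E - X) + mset_set X0" using mset_set_Union[of "E - X" X0] fin disj by simp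
  have "image_mset f (mset_set (V - A)) = image_mset g (mset_set (V - A))"
    by (rule image_mset_cong) (use f fin in auto)
  then have 1: "image_mset f (mset_set V) = M + b" using V V0 g x by (simp add: ac_simps)
  have "elabel c f e = elabel c0 g e" if e: "e \<in> E - X" for e
  proof -
    have "sum f e = sum g e" by (rule sum.cong) (use old[OF e] f in auto)
    then show ?thesis using old[OF e] by (simp add: elabel_def)
  qed
  then have "image_mset (elabel c f) (mset_set (E - X)) = image_mset (elabel c0 g) (mset_set (E - X))"
    by (intro image_mset_cong) (use fin in auto)
  then have 2: "image_mset (elabel c f) (mset_set E) = image_mset (elabel c0 g) (mset_set (E - X \<union> X0)) + Y"
    using E E0 lab by (simp add: ac_simps)
  show ?thesis unfolding solvable_def using 1 2 bal by metis
qed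

lemma solvable_normalize:
  fixes c :: "'a set \<Rightarrow> 'l::ab_group_add"
  assumes H: "htree V E" and M: "balanced M" "size M = card V" and N: "\<not> normalized E"
    and IH: "\<And>V' E' (c' :: 'a set \<Rightarrow> 'l) M'. card V' < card V \<Longrightarrow> htree V' E' \<Longrightarrow> balanced M' \<Longrightarrow>
      size M' = card V' \<Longrightarrow> solvable V' E' c' M'"
  shows "solvable V E c M"
proof -
  obtain e v where e: "e \<in> E" "v \<in> e" "card e \<noteq> 2" and only: "\<And>x. x \<in> E \<Longrightarrow> v \<in> x \<Longrightarrow> x = e"
    using N unfolding normalized_def by blast
  have fin: "finite V" "finite E" using htree_finite[OF H] by auto
  have eV: "e \<subseteq> V" "3 \<le> card e" "finite e" using htree_edge[OF H e(1)] e by auto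
  note rv = htree_remove_vertex[OF H e(1,2) eV(2) only]
  have vV: "v \<in> V" using e eV by blast
  then have "M \<noteq> {#}" using M fin by (metis card_gt_0_iff empty_iff less_nat_zero_code size_empty)
  then obtain a where a: "a \<in># M" "balanced (M - {#a#})" using balanced_remove[OF M(1)] by blast
  define c0 where "c0 = c(e - {v} := c e + a)"
  have cd: "card (V - {v}) < card V" using vV fin by (meson card_Diff1_less)
  moreover have "size (M - {#a#}) = card (V - {v})" using a M fin vV by (simp add: size_Diff_singleton)
  ultimately obtain g where g: "image_mset g (mset_set (V - {v})) = M - {#a#}"
    "balanced (image_mset (elabel c0 g) (mset_set (insert (e - {v}) (E - {e}))))"
    using IH[OF _ rv(1) a(2), of c0] unfolding solvable_def by auto
  have eq: "sum (g(v := a)) e = a + sum g (e - {v})"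
    using eV(3) e(2) by (subst sum.remove[of e v]) (auto intro!: sum.cong)
  have "solvable V E c (M - {#a#} + {#a#})"
  proof (rule solvable_extend[where A = "{v}" and ?A0.0 = "{}" and X = "{e}" and ?X0.0 = "{e - {v}}" and g = g
        and f = "g(v := a)" and ?c0.0 = c0 and Y = "{#}"])
    show "x \<inter> {v} = {} \<and> c0 x = c x" if "x \<in> E - {e}" for x
      using that only[of x] rv(2) by (auto simp: c0_def)
    show "image_mset (elabel c (g(v := a))) (mset_set {e}) = image_mset (elabel c0 g) (mset_set {e - {v}}) + {#}"
      using eq by (simp add: elabel_def c0_def ac_simps)
  qed (use fin vV e rv(2) g in auto)
  then show ?thesis using a by simp
qed

definition pedge :: "('a \<Rightarrow> 'a) \<Rightarrow> 'a \<Rightarrow> 'a set" where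
  "pedge a u = {a u, u}"

lemma inj_on_pedge:
  assumes "\<And>u. u \<in> U \<Longrightarrow> a u \<notin> U"
  shows "inj_on (pedge a) U"
  using assms by (auto simp: inj_on_def pedge_def doubleton_eq_iff)

lemma pedge_labels:
  assumes "distinct us" "\<And>u. u \<in> set us \<Longrightarrow> a u \<notin> set us"
  shows "image_mset (elabel c f) (mset_set (pedge a ` set us)) = mset (map (\<lambda>u. c (pedge a u) + f (a u) + f u) us)"
proof -
  have "image_mset (elabel c f) (mset_set (pedge a ` set us)) = image_mset (\<lambda>u. elabel c f (pedge a u)) (mset_set (set us))"
    using image_mset_mset_set[OF inj_on_pedge[of "set us" a]] assms(2) by (metis (no_types, lifting) image_mset.compositionality comp_def image_mset_cong)
  also have "\<dots> = image_mset (\<lambda>u. c (pedge a u) + f (a u) + f u) (mset_set (set us))"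
  proof (rule image_mset_cong)
    fix u assume "u \<in># mset_set (set us)"
    then have "a u \<noteq> u" using assms(2)[of u] by auto
    then show "elabel c f (pedge a u) = c (pedge a u) + f (a u) + f u" by (simp add: elabel_def pedge_def add.assoc)
  qed
  finally show ?thesis using assms(1) by (simp add: mset_set_set)
qed

lemma image_mset_set_distinct: "distinct xs \<Longrightarrow> image_mset f (mset_set (set xs)) = mset (map f xs)"
  by (simp add: mset_set_set)

section \<open>Reductions\<close>

locale reduction_step =
  fixes V :: "'a set" and E :: "'a set set" and c :: "'a set \<Rightarrow> 'l::{ab_group_add,finite}" and M :: "'l multiset"
  assumes H: "htree V E" and normalized: "normalized E" and balanced_M: "balanced M" and size_M: "size M = card V"
    and IH: "\<And>V' E' (c' :: 'a set \<Rightarrow> 'l) M'. card V' < card V \<Longrightarrow> htree V' E' \<Longrightarrow> balanced M' \<Longrightarrow>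
      size M' = card V' \<Longrightarrow> solvable V' E' c' M'"
begin

lemma finite_V: "finite V" and finite_E: "finite E"
  using htree_finite[OF H] by auto

lemma htree_remove_pedges:
  assumes "\<And>u. u \<in> set us \<Longrightarrow> pendant E (a u) u \<and> a u \<notin> set us"
  shows "htree (V - set us) (E - pedge a ` set us)"
  using htree_remove_pendants[OF finite_set H, of us a] assms unfolding pedge_def[abs_def] by blast

lemma pendant_in_V: "pendant E q u \<Longrightarrow> q \<in> V \<and> u \<in> V"
  using htree_edge(1)[OF H] by (auto simp: pendant_def)

lemma pendant_edge_eq: "pendant E (a u) u \<Longrightarrow> x \<in> E \<Longrightarrow> u \<in> x \<Longrightarrow> x = pedge a u"
  by (auto simp: pendant_def pedge_def)

text \<open>
  Here \<open>us\<close> are deleted vertices of degree one, \<open>rs\<close> are vertices that are deleted from \<open>e\<close>, and \<open>ks\<close> are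
  vertices of \<open>e\<close> that have degree one in the smaller hypertree and may be relabelled. The
  constant of \<open>e\<close> is raised by \<open>\<kappa>\<close> in the smaller hypertree, where \<open>e\<close> gets the label \<open>y\<close>.
\<close>
lemma reduce_keep:
  assumes e: "e \<in> E" and dist: "distinct (us @ rs @ ks)" and ne: "us \<noteq> []"
    and pend: "\<And>u. u \<in> set us \<Longrightarrow> pendant E (a u) u \<and> a u \<notin> set us \<and> pedge a u \<noteq> e"
    and sub: "set (rs @ ks) \<subseteq> e"
    and rs: "rs = [] \<or> (\<exists>q. rs = [q]) \<and> 3 \<le> card e"
    and only: "\<And>q x. q \<in> set (rs @ ks) \<Longrightarrow> x \<in> E \<Longrightarrow> q \<in> x \<Longrightarrow> x = e \<or> x \<in> pedge a ` set us"
    and M: "M = M' + mset bs" "balanced M'" "length bs = length us + length rs"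
    and ts: "mset ts = repeat_mset n (mset_set UNIV)"
    and solve: "\<And>g y. \<exists>x. mset (map x (us @ rs @ ks)) = mset (map g ks @ bs) \<and>
      mset (map (\<lambda>u. c (pedge a u) + (if a u \<in> set (rs @ ks) then x (a u) else g (a u)) + x u) us @
        [y - \<kappa> + sum_list (map x (rs @ ks)) - sum_list (map g ks)]) = mset (y # ts)"
  shows "solvable V E c M"
proof -
  let ?U = "set us" and ?Y = "pedge a ` set us" and ?R = "set rs" and ?Q = "set (rs @ ks)" and ?A = "set (us @ rs @ ks)"
  let ?X = "insert e ?Y"
  have eV: "e \<subseteq> V" "finite e" using htree_edge[OF H e] by auto
  have U: "?U \<subseteq> V" using pend pendant_in_V by blast
  have Y: "?Y \<subseteq> E" using pend by (auto simp: pendant_def pedge_def)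
  have eY: "e \<notin> ?Y" using pend by blast
  have Ue: "u \<notin> e" if "u \<in> ?U" for u using pend[OF that] pendant_edge_eq e by blast
  have h0: "htree (V - ?U) (E - ?Y)" using htree_remove_pedges pend by blast
  \<comment> \<open>If \<open>e\<close> loses a vertex, \<open>3 \<le> card e\<close> keeps it an
    edge. That \<open>e - ?R\<close> is not one of the other edges makes the redefinition of its
    constant harmless.\<close>
  have h: "htree (V - ?U - ?R) (insert (e - ?R) (E - ?X)) \<and> e - ?R \<notin> E - ?X"
  proof (cases "rs = []")
    case True
    have "insert e (E - ?X) = E - ?Y" using e eY by auto
    then show ?thesis using True h0 by auto
  next
    case False
    then obtain q where q: "rs = [q]" "3 \<le> card e" using rs by blast
    have only_q: "x = e" if "x \<in> E - ?Y" "q \<in> x" for x using only[of q x] that q(1) by auto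
    have eq: "e \<in> E - ?Y" "q \<in> e" using e eY q(1) sub by auto
    note r = htree_remove_vertex[OF h0 eq q(2) only_q]
    have "E - ?Y - {e} = E - ?X" by auto
    with r q show ?thesis by auto
  qed
  define c0 where "c0 = c(e - ?R := c e + \<kappa>)"
  have RV: "?R \<subseteq> V" "set ks \<subseteq> V" using sub eV by auto
  have "V - ?U - ?R = V - (?U \<union> ?R)" by auto
  then have "card (V - ?U - ?R) = card V - card (?U \<union> ?R)"
    using card_Diff_subset[of "?U \<union> ?R" V] U RV by simp
  also have "card (?U \<union> ?R) = length us + length rs" using dist by (subst card_Un_disjoint) (auto simp: distinct_card)
  finally have cV: "card (V - ?U - ?R) = card V - (length us + length rs)" .
  have "length us + length rs \<le> card V" using size_M M by auto
  moreover have "0 < length us" using ne by simp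
  ultimately have "card (V - ?U - ?R) < card V" using cV by linarith
  moreover have "size M' = card (V - ?U - ?R)" using cV size_M M by auto
  ultimately have "solvable (V - ?U - ?R) (insert (e - ?R) (E - ?X)) c0 M'" using IH h M(2) by blast
  then obtain g where g: "image_mset g (mset_set (V - ?U - ?R)) = M'"
    "balanced (image_mset (elabel c0 g) (mset_set (insert (e - ?R) (E - ?X))))"
    unfolding solvable_def by blast
  define y where "y = elabel c0 g (e - ?R)"
  obtain x where x: "mset (map x (us @ rs @ ks)) = mset (map g ks) + mset bs"
    "mset (map (\<lambda>u. c (pedge a u) + (if a u \<in> ?Q then x (a u) else g (a u)) + x u) us) +
        {#y - \<kappa> + sum_list (map x (rs @ ks)) - sum_list (map g ks)#} = {#y#} + repeat_mset n (mset_set UNIV)"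
    using solve[of g y] ts by auto
  define f where "f v = (if v \<in> ?A then x v else g v)" for v
  have V0: "V - ?A \<union> set ks = V - ?U - ?R" using dist RV by auto
  have E0: "E - ?X \<union> {e - ?R} = insert (e - ?R) (E - ?X)" by auto
  \<comment> \<open>\<open>y\<close> contains \<open>\<kappa>\<close> and the old labels of
    \<open>ks\<close>. The label of \<open>e\<close> in the given hypertree trades them for the new
    labels of \<open>rs\<close> and \<open>ks\<close>.\<close>
  have fe: "elabel c f e = y - \<kappa> + sum_list (map x (rs @ ks)) - sum_list (map g ks)"
  proof -
    have "sum f e = sum f (e - ?Q) + sum f ?Q" using sub eV by (metis sum.subset_diff)
    also have "sum f (e - ?Q) = sum g (e - ?Q)" by (rule sum.cong) (use Ue in \<open>auto simp: f_def\<close>)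
    also have "sum f ?Q = sum x ?Q" by (rule sum.cong) (auto simp: f_def)
    also have "sum x ?Q = sum_list (map x (rs @ ks))" using dist by (subst sum_list_distinct_conv_sum_set) auto
    finally have 1: "sum f e = sum g (e - ?Q) + sum_list (map x (rs @ ks))" .
    have "e - ?R = (e - ?Q) \<union> set ks" using sub dist by auto
    moreover have "sum g ((e - ?Q) \<union> set ks) = sum g (e - ?Q) + sum g (set ks)" by (rule sum.union_disjoint) (use eV in auto)
    moreover have "sum g (set ks) = sum_list (map g ks)" using dist by (subst sum_list_distinct_conv_sum_set) auto
    ultimately have "sum g (e - ?R) = sum g (e - ?Q) + sum_list (map g ks)" by simp
    then show ?thesis using 1 by (simp add: y_def elabel_def c0_def algebra_simps)
  qed
  have "solvable V E c (M' + mset bs)"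
  proof (rule solvable_extend[where A = ?A and ?A0.0 = "set ks" and X = ?X and ?X0.0 = "{e - ?R}" and g = g
        and f = f and ?c0.0 = c0 and Y = "repeat_mset n (mset_set UNIV)"])
    show "?A \<subseteq> V" using U RV by auto
    show "z \<inter> ?A = {} \<and> c0 z = c z" if z: "z \<in> E - ?X" for z
    proof
      have "u \<notin> z" if "u \<in> ?U" for u using z pend[OF that] pendant_edge_eq[of a u z] that by auto
      moreover have "q \<notin> z" if "q \<in> ?Q" for q using only[OF that, of z] z by blast
      ultimately show "z \<inter> ?A = {}" by auto
      show "c0 z = c z" using z h by (auto simp: c0_def)
    qed
    show "image_mset g (mset_set (V - ?A \<union> set ks)) = M'" using g V0 by simp
    show "balanced (image_mset (elabel c0 g) (mset_set (E - ?X \<union> {e - ?R})) + repeat_mset n (mset_set UNIV))"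
      unfolding E0 balanced_add_repeat_full by (rule g(2))
    have "image_mset f (mset_set ?A) = mset (map f (us @ rs @ ks))" by (rule image_mset_set_distinct[OF dist])
    also have "map f (us @ rs @ ks) = map x (us @ rs @ ks)" by (rule map_cong) (auto simp: f_def)
    finally show "image_mset f (mset_set ?A) = image_mset g (mset_set (set ks)) + mset bs"
      using x(1) image_mset_set_distinct[of ks g] dist by simp
    have "image_mset (elabel c f) (mset_set ?Y) = mset (map (\<lambda>u. c (pedge a u) + f (a u) + f u) us)"
      by (rule pedge_labels) (use dist pend in auto)
    also have "map (\<lambda>u. c (pedge a u) + f (a u) + f u) us =
        map (\<lambda>u. c (pedge a u) + (if a u \<in> ?Q then x (a u) else g (a u)) + x u) us"
      by (rule map_cong) (use pend in \<open>auto simp: f_def\<close>)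
    finally have "image_mset (elabel c f) (mset_set ?X) =
        mset (map (\<lambda>u. c (pedge a u) + (if a u \<in> ?Q then x (a u) else g (a u)) + x u) us) + {#elabel c f e#}"
      using eY by simp
    then show "image_mset (elabel c f) (mset_set ?X) = image_mset (elabel c0 g) (mset_set {e - ?R}) + repeat_mset n (mset_set UNIV)"
      unfolding fe x(2) by (simp add: y_def)
  qed (use h Y e finite_V finite_E dist in \<open>auto simp: f_def\<close>)
  then show ?thesis using M(1) by simp
qed

text \<open>Here \<open>e\<close> is deleted as well, so its label counts towards the full sets.
  What remains meets \<open>e\<close> only in \<open>p\<close>, whose label \<open>g p\<close>
  cannot be chosen.\<close>

lemma reduce_remove:
  assumes e: "e \<in> E" "p \<in> e" "set rs = e - {p}" and dist: "distinct (us @ rs)" 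
    and pend: "\<And>u. u \<in> set us \<Longrightarrow> pendant E (a u) u \<and> a u \<notin> set us \<and> pedge a u \<noteq> e"
    and only: "\<And>q x. q \<in> set rs \<Longrightarrow> x \<in> E \<Longrightarrow> q \<in> x \<Longrightarrow> x = e \<or> x \<in> pedge a ` set us"
    and M: "M = M' + mset bs" "balanced M'" "length bs = length us + length rs"
    and ts: "mset ts = repeat_mset n (mset_set UNIV)"
    and solve: "\<And>g. \<exists>x. mset (map x (us @ rs)) = mset bs \<and>
      mset (map (\<lambda>u. c (pedge a u) + (if a u \<in> set rs then x (a u) else g (a u)) + x u) us @
        [c e + g p + sum_list (map x rs)]) = mset ts"
  shows "solvable V E c M"
proof -
  let ?U = "set us" and ?Y = "pedge a ` set us" and ?R = "set rs" and ?A = "set (us @ rs)"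
  let ?X = "insert e ?Y"
  have eV: "e \<subseteq> V" "finite e" "2 \<le> card e" using htree_edge[OF H e(1)] by auto
  have U: "?U \<subseteq> V" using pend pendant_in_V by blast
  have Y: "?Y \<subseteq> E" using pend by (auto simp: pendant_def pedge_def)
  have eY: "e \<notin> ?Y" using pend by blast
  have Ue: "u \<notin> e" if "u \<in> ?U" for u using pend[OF that] pendant_edge_eq e by blast
  have h0: "htree (V - ?U) (E - ?Y)" using htree_remove_pedges pend by blast
  have "htree (V - ?U - (e - {p})) (E - ?Y - {e})"
    by (rule htree_remove_leaf_edge[OF h0]) (use e eY only in blast)+
  moreover have "E - ?Y - {e} = E - ?X" by auto
  moreover have RV: "V - ?U - (e - {p}) = V - ?A" using e(3) by auto
  ultimately have h: "htree (V - ?A) (E - ?X)" by simp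
  have AV: "?A \<subseteq> V" using U e(3) eV by auto
  have cA: "card ?A = length us + length rs" using distinct_card[OF dist] by simp
  have cV: "card (V - ?A) = card V - (length us + length rs)" "length us + length rs \<le> card V"
    using card_Diff_subset[of ?A V] card_mono[OF finite_V AV] AV cA by simp_all
  have "card ?R = card e - 1" using e eV by simp
  then have "rs \<noteq> []" using eV by auto
  then have "0 < length rs" by simp
  then have "card (V - ?A) < card V" using cV by linarith
  moreover have "size M' = card (V - ?A)" using cV size_M M by auto
  ultimately have "solvable (V - ?A) (E - ?X) c M'" using IH h M(2) by blast
  then obtain g where g: "image_mset g (mset_set (V - ?A)) = M'"
    "balanced (image_mset (elabel c g) (mset_set (E - ?X)))"
    unfolding solvable_def by blast
  obtain x where x: "mset (map x (us @ rs)) = mset bs"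
    "mset (map (\<lambda>u. c (pedge a u) + (if a u \<in> set rs then x (a u) else g (a u)) + x u) us) +
        {#c e + g p + sum_list (map x rs)#} = repeat_mset n (mset_set UNIV)"
    using solve[of g] ts by auto
  define f where "f v = (if v \<in> ?A then x v else g v)" for v
  have fe: "elabel c f e = c e + g p + sum_list (map x rs)"
  proof -
    have "sum f e = f p + sum f (e - {p})" using e eV by (simp add: sum.remove)
    also have "f p = g p" using Ue[of p] e by (auto simp: f_def)
    also have "sum f (e - {p}) = sum x ?R" unfolding e(3)[symmetric] by (rule sum.cong) (auto simp: f_def)
    also have "sum x ?R = sum_list (map x rs)" using dist by (subst sum_list_distinct_conv_sum_set) auto
    finally show ?thesis by (simp add: elabel_def add.assoc)
  qed
  have "solvable V E c (M' + mset bs)"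
  proof (rule solvable_extend[where A = ?A and ?A0.0 = "{}" and X = ?X and ?X0.0 = "{}" and g = g
        and f = f and ?c0.0 = c and Y = "repeat_mset n (mset_set UNIV)"])
    show "z \<inter> ?A = {} \<and> c z = c z" if z: "z \<in> E - ?X" for z
    proof -
      have "u \<notin> z" if "u \<in> ?U" for u using z pend[OF that] pendant_edge_eq[of a u z] that by auto
      moreover have "q \<notin> z" if "q \<in> ?R" for q using only[OF that, of z] z by blast
      ultimately show ?thesis by auto
    qed
    show "balanced (image_mset (elabel c g) (mset_set (E - ?X \<union> {})) + repeat_mset n (mset_set UNIV))"
      using g(2) by (simp add: balanced_add_repeat_full)
    have "image_mset f (mset_set ?A) = mset (map f (us @ rs))" by (rule image_mset_set_distinct[OF dist])
    also have "map f (us @ rs) = map x (us @ rs)" by (rule map_cong) (auto simp: f_def)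
    finally show "image_mset f (mset_set ?A) = image_mset g (mset_set {}) + mset bs" using x(1) by simp
    have "image_mset (elabel c f) (mset_set ?Y) = mset (map (\<lambda>u. c (pedge a u) + f (a u) + f u) us)"
      by (rule pedge_labels) (use dist pend in auto)
    also have "map (\<lambda>u. c (pedge a u) + f (a u) + f u) us =
        map (\<lambda>u. c (pedge a u) + (if a u \<in> set rs then x (a u) else g (a u)) + x u) us"
      by (rule map_cong) (use pend in \<open>auto simp: f_def\<close>)
    finally have "image_mset (elabel c f) (mset_set ?X) =
        mset (map (\<lambda>u. c (pedge a u) + (if a u \<in> set rs then x (a u) else g (a u)) + x u) us) + {#elabel c f e#}"
      using eY by simp
    then show "image_mset (elabel c f) (mset_set ?X) = image_mset (elabel c g) (mset_set {}) + repeat_mset n (mset_set UNIV)"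
      unfolding fe x(2) by simp
  qed (use AV Y e g finite_V finite_E in \<open>auto simp: f_def\<close>)
  then show ?thesis using M(1) by simp
qed

text \<open>By \<open>dvd\<close> the induction hypothesis gives all labels equally often on the
  remaining edges, so the new labels need only be balanced. This handles the base cases, in which
  there are too few edges for a full set.\<close>

lemma reduce_pendants:
  assumes dist: "distinct us" and ne: "us \<noteq> []"
    and pend: "\<And>u. u \<in> set us \<Longrightarrow> pendant E (a u) u \<and> a u \<notin> set us"
    and dvd: "card (UNIV :: 'l set) dvd card E - length us"
    and M: "M = M' + mset bs" "balanced M'" "length bs = length us"
    and solve: "\<And>g. \<exists>x. mset (map x us) = mset bs \<and> balanced (mset (map (\<lambda>u. c (pedge a u) + g (a u) + x u) us))"
  shows "solvable V E c M"
proof -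
  let ?U = "set us" and ?Y = "pedge a ` set us"
  have U: "?U \<subseteq> V" using pend pendant_in_V by blast
  have Y: "?Y \<subseteq> E" using pend by (auto simp: pendant_def pedge_def)
  have h: "htree (V - ?U) (E - ?Y)" using htree_remove_pedges pend by blast
  have cU: "card ?U = length us" using distinct_card[OF dist] .
  then have cV: "card (V - ?U) = card V - length us" "length us \<le> card V"
    using card_Diff_subset[of ?U V] card_mono[OF finite_V U] U by simp_all
  have "0 < length us" using ne by simp
  then have "card (V - ?U) < card V" using cV by linarith
  moreover have "size M' = card (V - ?U)" using cV size_M M by auto
  ultimately have "solvable (V - ?U) (E - ?Y) c M'" using IH h M(2) by blast
  then obtain g where g: "image_mset g (mset_set (V - ?U)) = M'"
    "balanced (image_mset (elabel c g) (mset_set (E - ?Y)))"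
    unfolding solvable_def by blast
  obtain x where x: "mset (map x us) = mset bs" "balanced (mset (map (\<lambda>u. c (pedge a u) + g (a u) + x u) us))"
    using solve[of g] by blast
  define f where "f v = (if v \<in> ?U then x v else g v)" for v
  have "card ?Y = length us" using card_image[OF inj_on_pedge[of ?U a]] pend cU by simp
  then have cE: "card (E - ?Y) = card E - length us" using Y by (simp add: card_Diff_subset)
  have lab: "image_mset (elabel c f) (mset_set ?Y) = mset (map (\<lambda>u. c (pedge a u) + g (a u) + x u) us)"
  proof -
    have "image_mset (elabel c f) (mset_set ?Y) = mset (map (\<lambda>u. c (pedge a u) + f (a u) + f u) us)"
      by (rule pedge_labels) (use dist pend in auto)
    also have "map (\<lambda>u. c (pedge a u) + f (a u) + f u) us = map (\<lambda>u. c (pedge a u) + g (a u) + x u) us"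
      by (rule map_cong) (use pend in \<open>auto simp: f_def\<close>)
    finally show ?thesis .
  qed
  have "solvable V E c (M' + mset bs)"
  proof (rule solvable_extend[where A = ?U and ?A0.0 = "{}" and X = ?Y and ?X0.0 = "{}" and g = g
        and f = f and ?c0.0 = c and Y = "mset (map (\<lambda>u. c (pedge a u) + g (a u) + x u) us)"])
    show "z \<inter> ?U = {} \<and> c z = c z" if z: "z \<in> E - ?Y" for z
      using z pend pendant_edge_eq[of a _ z] by blast
    show "balanced (image_mset (elabel c g) (mset_set (E - ?Y \<union> {})) + mset (map (\<lambda>u. c (pedge a u) + g (a u) + x u) us))"
      using balanced_divisible_add[OF g(2) _ x(2)] dvd cE by simp
    have "image_mset f (mset_set ?U) = mset (map f us)" by (rule image_mset_set_distinct[OF dist])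
    also have "map f us = map x us" by (rule map_cong) (auto simp: f_def)
    finally show "image_mset f (mset_set ?U) = image_mset g (mset_set {}) + mset bs" using x(1) by simp
  qed (use U Y g lab finite_V finite_E in \<open>auto simp: f_def\<close>)
  then show ?thesis using M(1) by simp
qed

end

section \<open>Parents of leaves, and hypertrees with very few edges\<close>

context reduction_step
begin

definition par :: "'a \<Rightarrow> 'a" where "par u = (SOME q. pendant E q u)"

lemma par_eq: 
  assumes "pendant E q u"
  shows "par u = q"
proof -
  have "pendant E (par u) u" unfolding par_def using assms by (rule someI)
  then show ?thesis using assms by (auto simp: pendant_def doubleton_eq_iff)
qed

lemma solvable_no_edges:
  assumes "E = {}"
  shows "solvable V E c M"
proof -
  obtain r where r: "r \<in> V" using H by (auto simp: htree_def)
  then obtain d where "levelled r d V E" using H by (auto simp: htree_def)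
  then have "V = {r}" using levelled_parent[of r d V E] assms r by blast
  moreover from this obtain a where "M = {#a#}" using size_M size_1_singleton_mset[of M] by auto
  ultimately show ?thesis unfolding solvable_def assms by (intro exI[of _ "\<lambda>_. a"]) (simp add: balanced_def)
qed

lemma solvable_one_more:
  assumes "card (UNIV :: 'l set) dvd card E - 1" "E \<noteq> {}"
  shows "solvable V E c M"
proof -
  obtain q u where qu: "pendant E q u" using normalized_leaf[OF H normalized assms(2)] by blast
  have "V \<noteq> {}" using H by (simp add: htree_def)
  then have "M \<noteq> {#}" using size_M finite_V by (metis card_0_eq size_empty)
  then obtain a where a: "a \<in># M" "balanced (M - {#a#})" using balanced_remove[OF balanced_M] by blast
  show ?thesis
    by (rule reduce_pendants[where us = "[u]" and a = par and M' = "M - {#a#}" and bs = "[a]"])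
      (use par_eq[OF qu] qu a assms(1) in \<open>auto simp: pendant_def balanced_single\<close>)
qed

end

text \<open>
  The pendant vertex \<open>r\<close> is the root, used as a spare leaf; \<open>e\<close> is the edge above a deepest edge, with
  highest vertex \<open>p\<close>.
\<close>
locale bottom_step = reduction_step V E c M
  for V :: "'a set" and E :: "'a set set" and c :: "'a set \<Rightarrow> 'l::{ab_group_add,finite}" and M :: "'l multiset" +
  fixes e :: "'a set" and p s r :: 'a
  assumes e: "e \<in> E" "p \<in> e" and sr: "pendant E s r"
    and ext: "p \<noteq> r \<Longrightarrow> s \<notin> e - {p}" "p \<noteq> r \<Longrightarrow> {s, r} \<noteq> e"
    and ex_child: "\<And>q. q \<in> e - {p} \<Longrightarrow> \<exists>u. pendant E q u \<and> {q, u} \<noteq> e"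
    and all_child: "\<And>q x. q \<in> e - {p} \<Longrightarrow> x \<in> E \<Longrightarrow> q \<in> x \<Longrightarrow> x \<noteq> e \<Longrightarrow> \<exists>u. pendant E q u \<and> x = {q, u}"
    and root: "p = r \<Longrightarrow> \<exists>q. e = {p, q} \<and> (\<forall>x\<in>E. q \<in> x)"
begin

text \<open>The children of \<open>q\<close>. The condition \<open>{q, u} \<noteq> e\<close> matters
  when \<open>p = r\<close>, where \<open>e\<close> itself is a pendant edge.\<close>

definition K :: "'a \<Rightarrow> 'a set" where "K q = {u. pendant E q u \<and> {q, u} \<noteq> e}"

lemma K_D:
  assumes "u \<in> K q"
  shows "pendant E q u" "par u = q" "pedge par u \<noteq> e" "u \<notin> e" "u \<in> V" "u \<noteq> q"
proof -
  show u: "pendant E q u" using assms by (simp add: K_def)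
  show "par u = q" by (rule par_eq[OF u])
  then show "pedge par u \<noteq> e" using assms by (simp add: K_def pedge_def)
  show "u \<notin> e" using u assms e by (auto simp: K_def pendant_def)
  show "u \<in> V" "u \<noteq> q" using pendant_in_V[OF u] u by (auto simp: pendant_def)
qed

lemma K_pend: "u \<in> K q \<Longrightarrow> q \<notin> U \<Longrightarrow> pendant E (par u) u \<and> par u \<notin> U \<and> pedge par u \<noteq> e"
  using K_D(1-3)[of u q] by simp

lemma finite_K: "finite (K q)"
  using K_D(5) finite_V by (meson finite_subset subsetI)

lemma K_nonempty: "q \<in> e - {p} \<Longrightarrow> K q \<noteq> {}"
  using ex_child by (auto simp: K_def)

lemma K_disjoint: "u \<in> K q \<Longrightarrow> u \<in> K q' \<Longrightarrow> q = q'"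
  using K_D(2) by metis

text \<open>Once all its children are deleted, \<open>q\<close> lies in no edge but
  \<open>e\<close>, and can be deleted or relabelled without touching any other edge.\<close>

lemma K_only:
  assumes "q \<in> e - {p}" "x \<in> E" "q \<in> x" "K q \<subseteq> U"
  shows "x = e \<or> x \<in> pedge par ` U"
proof (cases "x = e")
  case False
  then obtain u where u: "pendant E q u" "x = {q, u}" using all_child[OF assms(1-3)] by blast
  then have "u \<in> K q" using False by (simp add: K_def)
  moreover have "x = pedge par u" using u par_eq by (simp add: pedge_def)
  ultimately show ?thesis using assms(4) by blast
qed simp

text \<open>For \<open>p \<noteq> r\<close> the leaf \<open>r\<close> and its edge are disjoint from
  the deleted children and different from \<open>e\<close>, so they can be deleted together with
  them.\<close>

lemma ext_D:
  assumes "p \<noteq> r"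
  shows "par r = s" "pedge par r \<noteq> e" "r \<notin> e" "r \<in> V" "r \<noteq> s" "q \<in> e - {p} \<Longrightarrow> r \<notin> K q" "u \<in> K q \<Longrightarrow> q \<in> e - {p} \<Longrightarrow> s \<noteq> u"
proof -
  show par: "par r = s" using par_eq[OF sr] .
  then show "pedge par r \<noteq> e" using ext(2)[OF assms] by (simp add: pedge_def)
  show re: "r \<notin> e" using sr ext(2)[OF assms] e by (auto simp: pendant_def)
  show "r \<in> V" "r \<noteq> s" using pendant_in_V[OF sr] sr by (auto simp: pendant_def)
  show "r \<notin> K q" if "q \<in> e - {p}" using that K_D(2)[of r q] par ext(1)[OF assms] by auto
  show "s \<noteq> u" if u: "u \<in> K q" "q \<in> e - {p}"
  proof
    assume "s = u"
    then have "{u, r} = {q, u}" using sr K_D(1)[OF u(1)] by (auto simp: pendant_def)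
    then have "r = q" using \<open>r \<noteq> s\<close> \<open>s = u\<close> by (auto simp: doubleton_eq_iff)
    then show False using re u by blast
  qed
qed

lemma card_V_ge: "distinct vs \<Longrightarrow> set vs \<subseteq> V \<Longrightarrow> length vs \<le> card V"
  by (metis card_mono distinct_card finite_V)

lemma e_V: "e \<subseteq> V" "finite e" "2 \<le> card e"
  using htree_edge[OF H e(1)] by auto

end

lemma (in reduction_step) bottom_exists:
  assumes "2 \<le> card E"
  obtains e p s r where "bottom_step V E M e p s r"
proof -
  show thesis
  proof (rule normalized_structure[OF H normalized assms])
    fix e p r s
    assume *: "e \<in> E" "p \<in> e" "pendant E s r" "r \<notin> e - {p}" "p \<noteq> r \<Longrightarrow> s \<notin> e - {p}" "p \<noteq> r \<Longrightarrow> {s, r} \<noteq> e"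
      "\<And>q. q \<in> e - {p} \<Longrightarrow> \<exists>u. pendant E q u \<and> {q, u} \<noteq> e"
      "\<And>q x. q \<in> e - {p} \<Longrightarrow> x \<in> E \<Longrightarrow> q \<in> x \<Longrightarrow> x \<noteq> e \<Longrightarrow> \<exists>u. pendant E q u \<and> x = {q, u}"
      "p = r \<Longrightarrow> \<exists>q. e = {p, q} \<and> (\<forall>x\<in>E. q \<in> x)"
    have "bottom_step_axioms E e p s r"
      by (rule bottom_step_axioms.intro) (fact *)+
    then have "bottom_step V E M e p s r"
      by (rule bottom_step.intro[OF reduction_step_axioms])
    then show thesis by (rule that)
  qed
qed

section \<open>Finite checks for labels modulo 2 and 3\<close>

text \<open>An enumerable type with executable addition lets quantifiers over all labels be decided
  by evaluation.\<close>

datatype z2 = B0 | B1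

instantiation z2 :: ab_group_add
begin
definition "0 = B0"
fun plus_z2 where "B0 + y = y" | "B1 + B0 = B1" | "B1 + B1 = B0"
definition "- x = (x::z2)"
definition "x - y = x + (y::z2)"
instance
proof
  fix a b c :: z2
  show "a + b + c = a + (b + c)" by (cases a; cases b; cases c; simp)
  show "a + b = b + a" by (cases a; cases b; simp)
  show "0 + a = a" by (simp add: zero_z2_def)
  show "- a + a = 0" by (cases a; simp add: zero_z2_def uminus_z2_def)
  show "a - b = a + - b" by (simp add: minus_z2_def uminus_z2_def)
qed
end

instantiation z2 :: enum
begin
definition "enum_z2 = [B0, B1]"
definition "enum_all_z2 P \<longleftrightarrow> P B0 \<and> P B1"
definition "enum_ex_z2 P \<longleftrightarrow> P B0 \<or> P B1"
instance
proof
  show u: "(UNIV :: z2 set) = set enum_class.enum" by (auto simp: enum_z2_def intro: z2.exhaust)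
  show "distinct (enum_class.enum :: z2 list)" by (simp add: enum_z2_def)
  fix P :: "z2 \<Rightarrow> bool"
  show "enum_class.enum_all P \<longleftrightarrow> Ball UNIV P" by (simp add: enum_all_z2_def u enum_z2_def)
  show "enum_class.enum_ex P \<longleftrightarrow> Bex UNIV P" by (simp add: enum_ex_z2_def u enum_z2_def)
qed
end

datatype z3 = Z0 | Z1 | Z2

instantiation z3 :: ab_group_add
begin
definition "0 = Z0"
fun plus_z3 where "Z0 + y = y" | "Z1 + Z0 = Z1" | "Z1 + Z1 = Z2" | "Z1 + Z2 = Z0" | "Z2 + Z0 = Z2" | "Z2 + Z1 = Z0" | "Z2 + Z2 = Z1"
fun uminus_z3 where "- Z0 = Z0" | "- Z1 = Z2" | "- Z2 = Z1"
definition "x - y = x + - (y::z3)"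
instance
proof
  fix a b c :: z3
  show "a + b + c = a + (b + c)" by (cases a; cases b; cases c; simp)
  show "a + b = b + a" by (cases a; cases b; simp)
  show "0 + a = a" by (simp add: zero_z3_def)
  show "- a + a = 0" by (cases a; simp add: zero_z3_def)
  show "a - b = a + - b" by (simp add: minus_z3_def)
qed
end

instantiation z3 :: enum
begin
definition "enum_z3 = [Z0, Z1, Z2]"
definition "enum_all_z3 P \<longleftrightarrow> P Z0 \<and> P Z1 \<and> P Z2"
definition "enum_ex_z3 P \<longleftrightarrow> P Z0 \<or> P Z1 \<or> P Z2"
instance
proof
  show u: "(UNIV :: z3 set) = set enum_class.enum" by (auto simp: enum_z3_def intro: z3.exhaust)
  show "distinct (enum_class.enum :: z3 list)" by (simp add: enum_z3_def)
  fix P :: "z3 \<Rightarrow> bool"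
  show "enum_class.enum_all P \<longleftrightarrow> Ball UNIV P" by (simp add: enum_all_z3_def u enum_z3_def)
  show "enum_class.enum_ex P \<longleftrightarrow> Bex UNIV P" by (simp add: enum_ex_z3_def u enum_z3_def)
qed
end


lemma UNIV_z2: "UNIV = {B0, B1}" by (auto intro: z2.exhaust)
lemma UNIV_z3: "UNIV = {Z0, Z1, Z2}" by (auto intro: z3.exhaust)
lemma mset_UNIV_z2: "mset_set UNIV = {#B0, B1#}" by (simp add: UNIV_z2)
lemma mset_UNIV_z3: "mset_set UNIV = {#Z0, Z1, Z2#}" by (simp add: UNIV_z3)

text \<open>
  \<open>match D P T\<close> searches for an assignment of the labels \<open>P\<close> to slots with offsets \<open>D\<close> such that the
  resulting sums are \<open>T\<close>. In \<open>game\<close>, two labels \<open>s\<close> and \<open>t\<close> for vertices of \<open>e\<close> are first taken from \<open>P\<close>; they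
  determine the offsets and the label \<open>l s t\<close> of \<open>e\<close>. The map \<open>h\<close> only speeds up the search: \<open>t\<close> is forced
  by \<open>s\<close> because the sum of all labels is known.
\<close>
fun match :: "'l::ab_group_add list \<Rightarrow> 'l list \<Rightarrow> 'l list \<Rightarrow> bool" where
  "match [] P T \<longleftrightarrow> P = [] \<and> T = []"
| "match (d # D) P T \<longleftrightarrow>
     list_ex (\<lambda>x. if d + x \<in> set T then match D (remove1 x P) (remove1 (d + x) T) else False) (remdups P)"

lemma match_sound:
  "match D P T \<Longrightarrow> \<exists>xs. length xs = length D \<and> mset xs = mset P \<and> mset (map2 (+) D xs) = mset T"
proof (induction D arbitrary: P T)
  case (Cons d D)
  then obtain x where x: "x \<in> set P" "d + x \<in> set T" "match D (remove1 x P) (remove1 (d + x) T)"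
    by (auto simp: list_ex_iff split: if_splits)
  from Cons.IH[OF x(3)] obtain xs where "length xs = length D" "mset xs = mset (remove1 x P)"
    "mset (map2 (+) D xs) = mset (remove1 (d + x) T)" by blast
  with x show ?case by (intro exI[of _ "x # xs"]) auto
qed auto

definition game :: "('l \<Rightarrow> 'l \<Rightarrow> 'l list) \<Rightarrow> ('l \<Rightarrow> 'l \<Rightarrow> 'l) \<Rightarrow> ('l \<Rightarrow> 'l) \<Rightarrow> 'l::ab_group_add list \<Rightarrow> 'l list \<Rightarrow> bool" where
  "game D l h P T \<longleftrightarrow> list_ex (\<lambda>s. let t = h s; P' = remove1 s P in
     if t \<in> set P' then
       if l s t \<in> set T then match (D s t) (remove1 t P') (remove1 (l s t) T) else False
     else False) (remdups P)"

lemma game_sound: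
  assumes "game D l h P T"
  obtains s t xs where "length xs = length (D s t)" "mset (xs @ [s, t]) = mset P"
    "mset (map2 (+) (D s t) xs @ [l s t]) = mset T"
proof -
  obtain s where s: "s \<in> set P" "h s \<in> set (remove1 s P)" "l s (h s) \<in> set T"
      "match (D s (h s)) (remove1 (h s) (remove1 s P)) (remove1 (l s (h s)) T)"
    using assms by (auto simp: game_def list_ex_iff Let_def split: if_splits)
  obtain xs where xs: "length xs = length (D s (h s))" "mset xs = mset (remove1 (h s) (remove1 s P))"
    "mset (map2 (+) (D s (h s)) xs) = mset (remove1 (l s (h s)) T)"
    using match_sound[OF s(4)] by blast
  have add: "add_mset a (mset (remove1 a as)) = mset as" if "a \<in> set as" for a and as :: "'l list"
    using that by simp
  have "mset (s # h s # xs) = mset P" using xs(2) add[OF s(2)] add[OF s(1)] by (metis mset.simps(2))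
  moreover have "mset (l s (h s) # map2 (+) (D s (h s)) xs) = mset T" using xs(3) add[OF s(3)] by (metis mset.simps(2))
  moreover have "mset (s # h s # xs) = mset (xs @ [s, h s])" "mset (l s (h s) # zs) = mset (zs @ [l s (h s)])" for zs
    by simp_all
  ultimately show thesis using that xs(1) by metis
qed

text \<open>
  The changes of the constant of \<open>e\<close> in the following lemmas, such as \<open>b + B1\<close> in \<open>game_two_fork\<close> or
  \<open>b - Z1\<close> in \<open>game_three_fork\<close>, must not depend on labels found by the induction hypothesis, that is,
  on \<open>y\<close>, \<open>\<psi>\<close> and the offsets of slots at surviving vertices.
\<close>
lemma game_two_same:
  "\<exists>x1 x2. {#x1, x2#} = {#B0, B1#} \<and> {#d1 + x1, d2 + x2, y - (d1 + d2)#} = {#y, B0, B1#}"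
proof -
  have "\<forall>d1 d2 y. \<exists>x1 x2. {#x1, x2#} = {#B0, B1#} \<and> {#d1 + x1, d2 + x2, y - (d1 + d2)#} = {#y, B0, B1#}"
    by code_simp
  then show ?thesis by blast
qed

text \<open>As \<open>s + x = B1\<close>, the first label is \<open>c + B1\<close> in any case, and
  \<open>s = c + h\<close> gives the second label the other value \<open>c\<close>.\<close>

lemma game_two_chain:
  "\<exists>s x. {#x, s#} = {#B0, B1#} \<and> {#c + s + x, h + s#} = {#B0, B1#}"
proof -
  have "\<forall>c h. \<exists>s x. {#x, s#} = {#B0, B1#} \<and> {#c + s + x, h + s#} = {#B0, B1#}" by code_simp
  then show ?thesis by blast
qed

text \<open>The sum condition is \<open>s = c + d + B1\<close>. If this is \<open>b\<close>, then
  \<open>e\<close> gets \<open>y + B1\<close>, both slots need \<open>y\<close>, and one of the two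
  orders of \<open>B0\<close>, \<open>B1\<close> achieves it. Otherwise \<open>e\<close> keeps
  \<open>y\<close>, and the two slots, both filled with \<open>b\<close>, get different labels. With
  \<open>b\<close> in place of \<open>b + B1\<close>, two slots both filled with \<open>b\<close>
  would have to hit a prescribed value.\<close>

lemma game_two_fork:
  "\<exists>s x1 x2. {#x1, x2, s#} = {#B0, B1, b#} \<and> {#c + s + x1, d + x2, y - (b + B1) + s#} = {#y, B0, B1#}"
proof -
  have "\<forall>b c d y. \<exists>s x1 x2. {#x1, x2, s#} = {#B0, B1, b#} \<and> {#c + s + x1, d + x2, y - (b + B1) + s#} = {#y, B0, B1#}"
    by code_simp
  then show ?thesis by blast
qed

text \<open>The labels placed have sum \<open>Z0\<close>, so the three slots add up to
  \<open>d1 + d2 + d3\<close>. The label of \<open>e\<close> is lowered by just this amount, which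
  makes the sums of both sides agree.\<close>

lemma game_three_same:
  "\<exists>x1 x2 x3. {#x1, x2, x3#} = {#Z0, Z1, Z2#} \<and>
     {#d1 + x1, d2 + x2, d3 + x3, y - (d1 + d2 + d3)#} = {#y, Z0, Z1, Z2#}"
proof -
  have "\<forall>d1 d2 d3 y. y - (d1 + d2 + d3) \<in> set [y, Z0, Z1, Z2] \<and>
      match [d1, d2, d3] [Z0, Z1, Z2] (remove1 (y - (d1 + d2 + d3)) [y, Z0, Z1, Z2])"
    by code_simp
  then have l: "y - (d1 + d2 + d3) \<in> set [y, Z0, Z1, Z2]"
    and m: "match [d1, d2, d3] [Z0, Z1, Z2] (remove1 (y - (d1 + d2 + d3)) [y, Z0, Z1, Z2])" by blast+
  obtain xs where xs: "length xs = length [d1, d2, d3]" "mset xs = mset [Z0, Z1, Z2]"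
    "mset (map2 (+) [d1, d2, d3] xs) = mset (remove1 (y - (d1 + d2 + d3)) [y, Z0, Z1, Z2])"
    using match_sound[OF m] by blast
  obtain x1 x2 x3 where "xs = [x1, x2, x3]" using xs(1) by (auto simp: length_Suc_conv)
  moreover have "mset (map2 (+) [d1, d2, d3] xs @ [y - (d1 + d2 + d3)]) = mset [y, Z0, Z1, Z2]"
    unfolding mset_append xs(3) using l by (metis add_mset_add_single insert_DiffM mset_remove1 mset_single_iff mset.simps set_mset_mset)
  ultimately have "{#x1, x2, x3#} = {#Z0, Z1, Z2#} \<and>
     {#d1 + x1, d2 + x2, d3 + x3, y - (d1 + d2 + d3)#} = {#y, Z0, Z1, Z2#}" using xs(2)
    by (simp only: append.simps mset.simps list.map zip_Cons_Cons zip_Nil prod.case simp_thms)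
  then show ?thesis by blast
qed

text \<open>The sum condition reads \<open>s = c1 + c2 + h\<close>; for this \<open>s\<close>, one
  order of the other two labels fits.\<close>

lemma game_three_cherry:
  "\<exists>s x1 x2. {#x1, x2, s#} = {#Z0, Z1, Z2#} \<and> {#c1 + s + x1, c2 + s + x2, h + s#} = {#Z0, Z1, Z2#}"
proof -
  have "\<forall>c1 c2 h. \<exists>s x1 x2. {#x1, x2, s#} = {#Z0, Z1, Z2#} \<and> {#c1 + s + x1, c2 + s + x2, h + s#} = {#Z0, Z1, Z2#}"
    by code_simp
  then show ?thesis by blast
qed

text \<open>Only one slot depends on \<open>s\<close>, which changes the sum condition to
  \<open>s = - (c + d + h)\<close>.\<close>

lemma game_three_chain:
  "\<exists>s x1 x2. {#x1, x2, s#} = {#Z0, Z1, Z2#} \<and> {#c + s + x1, d + x2, h + s#} = {#Z0, Z1, Z2#}"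
proof -
  have "\<forall>c d h. \<exists>s x1 x2. {#x1, x2, s#} = {#Z0, Z1, Z2#} \<and> {#c + s + x1, d + x2, h + s#} = {#Z0, Z1, Z2#}"
    by code_simp
  then show ?thesis by blast
qed

text \<open>Lowering \<open>e\<close> by \<open>b\<close> makes the sum condition
  \<open>s + t = - (c1 + c2 + g)\<close>, free of \<open>b\<close>, \<open>\<psi>\<close> and
  \<open>y\<close>.\<close>

lemma game_three_fork_ext:
  "\<exists>s t x1 x2 x3. {#x1, x2, x3, s, t#} = {#\<psi>, Z0, Z1, Z2, b#} \<and>
     {#c1 + s + x1, c2 + t + x2, g + x3, y - b + (s + t) - \<psi>#} = {#y, Z0, Z1, Z2#}"
proof -
  have "\<forall>b \<psi> c1 c2 g y. game (\<lambda>s t. [c1 + s, c2 + t, g]) (\<lambda>s t. y - b + (s + t) - \<psi>) (\<lambda>s. - (c1 + c2 + g) - s) [\<psi>, Z0, Z1, Z2, b] [y, Z0, Z1, Z2]"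
    by code_simp
  then have "game (\<lambda>s t. [c1 + s, c2 + t, g]) (\<lambda>s t. y - b + (s + t) - \<psi>) (\<lambda>s. - (c1 + c2 + g) - s) [\<psi>, Z0, Z1, Z2, b] [y, Z0, Z1, Z2]" by blast
  from game_sound[OF this] obtain s t zs where zs: "length zs = length [c1 + s, c2 + t, g]" "mset (zs @ [s, t]) = mset [\<psi>, Z0, Z1, Z2, b]"
    "mset (map2 (+) [c1 + s, c2 + t, g] zs @ [y - b + (s + t) - \<psi>]) = mset [y, Z0, Z1, Z2]" by metis
  obtain x1 x2 x3 where "zs = [x1, x2, x3]" using zs(1) by (auto simp: length_Suc_conv)
  with zs(2,3) have "{#x1, x2, x3, s, t#} = {#\<psi>, Z0, Z1, Z2, b#} \<and>
     {#c1 + s + x1, c2 + t + x2, g + x3, y - b + (s + t) - \<psi>#} = {#y, Z0, Z1, Z2#}"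
    by (simp only: append.simps mset.simps list.map zip_Cons_Cons zip_Nil prod.case simp_thms)
  then show ?thesis by blast
qed

text \<open>The sum condition is \<open>t = c1 + c2 + c3 + Z1 + s\<close>. The shift by
  \<open>Z1\<close> is essential: with \<open>b\<close> in place of \<open>b - Z1\<close>, the
  values \<open>c1 = c2 = c3 = b = y = Z0\<close> and \<open>\<psi> = Z1\<close> would force
  \<open>s = t\<close> and admit no solution.\<close>

lemma game_three_fork:
  "\<exists>s t x1 x2 x3. {#x1, x2, x3, s, t#} = {#\<psi>, Z0, Z1, Z2, b#} \<and>
     {#c1 + s + x1, c2 + t + x2, c3 + t + x3, y - (b - Z1) + (s + t) - \<psi>#} = {#y, Z0, Z1, Z2#}"
proof -
  have "\<forall>b \<psi> c1 c2 c3 y. game (\<lambda>s t. [c1 + s, c2 + t, c3 + t]) (\<lambda>s t. y - (b - Z1) + (s + t) - \<psi>) (\<lambda>s. c1 + c2 + c3 + Z1 + s) [\<psi>, Z0, Z1, Z2, b] [y, Z0, Z1, Z2]"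
    by code_simp
  then have "game (\<lambda>s t. [c1 + s, c2 + t, c3 + t]) (\<lambda>s t. y - (b - Z1) + (s + t) - \<psi>) (\<lambda>s. c1 + c2 + c3 + Z1 + s) [\<psi>, Z0, Z1, Z2, b] [y, Z0, Z1, Z2]" by blast
  from game_sound[OF this] obtain s t zs where zs: "length zs = length [c1 + s, c2 + t, c3 + t]" "mset (zs @ [s, t]) = mset [\<psi>, Z0, Z1, Z2, b]"
    "mset (map2 (+) [c1 + s, c2 + t, c3 + t] zs @ [y - (b - Z1) + (s + t) - \<psi>]) = mset [y, Z0, Z1, Z2]" by metis
  obtain x1 x2 x3 where "zs = [x1, x2, x3]" using zs(1) by (auto simp: length_Suc_conv)
  with zs(2,3) have "{#x1, x2, x3, s, t#} = {#\<psi>, Z0, Z1, Z2, b#} \<and>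
     {#c1 + s + x1, c2 + t + x2, c3 + t + x3, y - (b - Z1) + (s + t) - \<psi>#} = {#y, Z0, Z1, Z2#}"
    by (simp only: append.simps mset.simps list.map zip_Cons_Cons zip_Nil prod.case simp_thms)
  then show ?thesis by blast
qed

text \<open>Each of \<open>s\<close> and \<open>t\<close> enters three edges, twice in slots and
  once in \<open>e\<close>. With the known sum of the labels this gives
  \<open>s + t = c1 + c2 + c3 + c4 + g + h + b\<close>.\<close>

lemma game_three_two_cherries:
  "\<exists>s t x1 x2 x3 x4 x5. {#x1, x2, x3, x4, x5, s, t#} = {#Z0, Z1, Z2, Z0, Z1, Z2, b#} \<and>
     {#c1 + s + x1, c2 + s + x2, c3 + t + x3, c4 + t + x4, g + x5, h + (s + t)#} = {#Z0, Z1, Z2, Z0, Z1, Z2#}"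
proof -
  have "\<forall>b c1 c2 c3 c4 g h. game (\<lambda>s t. [c1 + s, c2 + s, c3 + t, c4 + t, g]) (\<lambda>s t. h + (s + t)) (\<lambda>s. c1 + c2 + c3 + c4 + g + h + b - s) [Z0, Z1, Z2, Z0, Z1, Z2, b] [Z0, Z1, Z2, Z0, Z1, Z2]"
    by code_simp
  then have "game (\<lambda>s t. [c1 + s, c2 + s, c3 + t, c4 + t, g]) (\<lambda>s t. h + (s + t)) (\<lambda>s. c1 + c2 + c3 + c4 + g + h + b - s) [Z0, Z1, Z2, Z0, Z1, Z2, b] [Z0, Z1, Z2, Z0, Z1, Z2]" by blast
  from game_sound[OF this] obtain s t zs where zs: "length zs = length [c1 + s, c2 + s, c3 + t, c4 + t, g]" "mset (zs @ [s, t]) = mset [Z0, Z1, Z2, Z0, Z1, Z2, b]"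
    "mset (map2 (+) [c1 + s, c2 + s, c3 + t, c4 + t, g] zs @ [h + (s + t)]) = mset [Z0, Z1, Z2, Z0, Z1, Z2]" by metis
  obtain x1 x2 x3 x4 x5 where "zs = [x1, x2, x3, x4, x5]" using zs(1) by (auto simp: length_Suc_conv)
  with zs(2,3) have "{#x1, x2, x3, x4, x5, s, t#} = {#Z0, Z1, Z2, Z0, Z1, Z2, b#} \<and>
     {#c1 + s + x1, c2 + s + x2, c3 + t + x3, c4 + t + x4, g + x5, h + (s + t)#} = {#Z0, Z1, Z2, Z0, Z1, Z2#}"
    by (simp only: append.simps mset.simps list.map zip_Cons_Cons zip_Nil prod.case simp_thms)
  then show ?thesis by blast
qed

text \<open>
  Translating all edge labels reduces the search to the case where \<open>y\<close> is zero.
\<close>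
lemma game_three_three_cherries:
  "\<exists>s t x1 x2 x3 x4 x5 x6. {#x1, x2, x3, x4, x5, x6, s, t#} = {#\<psi>, Z0, Z1, Z2, Z0, Z1, Z2, b#} \<and>
     {#c1 + s + x1, c2 + s + x2, c3 + t + x3, c4 + t + x4, d1 + x5, d2 + x6, y + (s + t) - \<psi>#} = {#y, Z0, Z1, Z2, Z0, Z1, Z2#}"
proof -
  have "\<forall>b \<psi> c1 c2 c3 c4 d1 d2. game (\<lambda>s t. [c1 + s, c2 + s, c3 + t, c4 + t, d1, d2]) (\<lambda>s t. s + t - \<psi>)
      (\<lambda>s. c1 + c2 + c3 + c4 + d1 + d2 + b - s) [\<psi>, Z0, Z1, Z2, Z0, Z1, Z2, b] [Z0, Z0, Z1, Z2, Z0, Z1, Z2]"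
    by code_simp
  then have "game (\<lambda>s t. [(c1 - y) + s, (c2 - y) + s, (c3 - y) + t, (c4 - y) + t, d1 - y, d2 - y]) (\<lambda>s t. s + t - \<psi>)
      (\<lambda>s. (c1 - y) + (c2 - y) + (c3 - y) + (c4 - y) + (d1 - y) + (d2 - y) + b - s)
      [\<psi>, Z0, Z1, Z2, Z0, Z1, Z2, b] [Z0, Z0, Z1, Z2, Z0, Z1, Z2]" by blast
  from game_sound[OF this] obtain s t zs where
    zs: "length zs = length [(c1 - y) + s, (c2 - y) + s, (c3 - y) + t, (c4 - y) + t, d1 - y, d2 - y]"
      "mset (zs @ [s, t]) = mset [\<psi>, Z0, Z1, Z2, Z0, Z1, Z2, b]"
      "mset (map2 (+) [(c1 - y) + s, (c2 - y) + s, (c3 - y) + t, (c4 - y) + t, d1 - y, d2 - y] zs @ [s + t - \<psi>]) =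
       mset [Z0, Z0, Z1, Z2, Z0, Z1, Z2]" by metis
  obtain x1 x2 x3 x4 x5 x6 where x: "zs = [x1, x2, x3, x4, x5, x6]" using zs(1) by (auto simp: length_Suc_conv)
  have "mset (map ((+) y) [(c1 - y) + s + x1, (c2 - y) + s + x2, (c3 - y) + t + x3, (c4 - y) + t + x4, d1 - y + x5, d2 - y + x6, s + t - \<psi>]) =
      mset (map ((+) y) [Z0, Z0, Z1, Z2, Z0, Z1, Z2])"
    using zs(3) unfolding x mset_map
    by (simp only: append.simps mset.simps list.map zip_Cons_Cons zip_Nil prod.case)
  moreover have "map ((+) y) [(c1 - y) + s + x1, (c2 - y) + s + x2, (c3 - y) + t + x3, (c4 - y) + t + x4, d1 - y + x5, d2 - y + x6, s + t - \<psi>] =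
      [c1 + s + x1, c2 + s + x2, c3 + t + x3, c4 + t + x4, d1 + x5, d2 + x6, y + (s + t) - \<psi>]"
    by (simp add: algebra_simps)
  moreover have "mset (map ((+) y) [Z0, Z0, Z1, Z2, Z0, Z1, Z2]) = mset [y, Z0, Z1, Z2, Z0, Z1, Z2]"
    by (cases y) simp_all
  ultimately have "mset [c1 + s + x1, c2 + s + x2, c3 + t + x3, c4 + t + x4, d1 + x5, d2 + x6, y + (s + t) - \<psi>] =
      mset [y, Z0, Z1, Z2, Z0, Z1, Z2]" by metis
  with zs(2) have "{#x1, x2, x3, x4, x5, x6, s, t#} = {#\<psi>, Z0, Z1, Z2, Z0, Z1, Z2, b#} \<and>
     {#c1 + s + x1, c2 + s + x2, c3 + t + x3, c4 + t + x4, d1 + x5, d2 + x6, y + (s + t) - \<psi>#} = {#y, Z0, Z1, Z2, Z0, Z1, Z2#}"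
    unfolding x by (simp only: append.simps mset.simps simp_thms)
  then show ?thesis by blast
qed

section \<open>The induction step modulo 2\<close>

text \<open>This and \<open>z3_triple\<close> let the change of the constant of \<open>e\<close> be
  fixed in advance when k children of one vertex are deleted: the unknown label of that vertex
  enters the sum k times.\<close>

lemma z2_double: "x + x = (0::z2)"
  by (cases x) (simp_all add: zero_z2_def)

lemma z3_triple: "x + x + x = (0::z3)"
  by (cases x) (simp_all add: zero_z3_def)

lemma full_z2: "mset [B0, B1] = repeat_mset 1 (mset_set UNIV)"
  by (simp add: mset_UNIV_z2)

lemma solvable_step_z2:
  fixes c :: "'a set \<Rightarrow> z2"
  assumes "reduction_step V E M"
  shows "solvable V E c M"
proof -
  interpret reduction_step V E c M by (rule assms)
  consider "E = {}" | "E \<noteq> {}" "card E - 1 = 0" | "2 \<le> card E"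
    by linarith
  then show ?thesis
  proof cases
    case 1
    then show ?thesis by (rule solvable_no_edges)
  next
    case 2
    then show ?thesis using solvable_one_more by simp
  next
    case 3
    then obtain e p s r where b: "bottom_step V E M e p s r" by (rule bottom_exists)
    interpret bottom_step V E c M e p s r by (rule b)
    let ?c = "\<lambda>u. c (pedge par u)"
    consider q where "q \<in> e - {p}" "2 \<le> card (K q)" | "\<And>q. q \<in> e - {p} \<Longrightarrow> card (K q) = 1"
      using K_nonempty finite_K by (metis One_nat_def Suc_1 card_gt_0_iff le_antisym not_less_eq_eq Suc_leI)
    then show ?thesis
    proof cases
      case (1 q)
      then obtain u1 u2 where u: "u1 \<in> K q" "u2 \<in> K q" "u1 \<noteq> u2"
        using finite_K by (metis card_le_Suc0_iff_eq not_less_eq_eq numeral_2_eq_2)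
      have par: "par u1 = q" "par u2 = q" using u K_D(2) by auto
      have "length [B0, B1] \<le> size M" using size_M card_V_ge[of "[u1, u2]"] u K_D(5) by simp
      then obtain N where N: "M = N + mset [B0, B1]" "balanced N" using balanced_take[OF full_z2 balanced_M] by blast
      show ?thesis
      proof (rule reduce_keep[where us = "[u1, u2]" and rs = "[]" and ks = "[]" and a = par and \<kappa> = "?c u1 + ?c u2",
            OF e(1) _ _ _ _ _ _ N _ full_z2])
        fix g :: "'a \<Rightarrow> z2" and y
        have eq: "(?c u1 + g q) + (?c u2 + g q) = ?c u1 + ?c u2" using z2_double[of "g q"] by (simp add: algebra_simps)
        obtain x1 x2 where x: "{#x1, x2#} = {#B0, B1#}"
          "{#(?c u1 + g q) + x1, (?c u2 + g q) + x2, y - ((?c u1 + g q) + (?c u2 + g q))#} = {#y, B0, B1#}"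
          using game_two_same by blast
        show "\<exists>x. mset (map x ([u1, u2] @ [] @ [])) = mset (map g [] @ [B0, B1]) \<and>
            mset (map (\<lambda>u. ?c u + (if par u \<in> set ([] @ []) then x (par u) else g (par u)) + x u) [u1, u2] @
            [y - (?c u1 + ?c u2) + sum_list (map x ([] @ [])) - sum_list (map g [])]) = mset (y # [B0, B1])"
          using x(1) x(2)[unfolded eq] u(3) par
          by (intro exI[of _ "(\<lambda>_. B0)(u1 := x1, u2 := x2)"]) auto
      qed (use u 1 K_D[OF u(1)] K_D[OF u(2)] in auto)
    next
      case 2
      show ?thesis
      proof (cases "card e = 2")
        \<comment> \<open>A pair \<open>e = {p, q}\<close> cannot lose a vertex and stay an edge, so
          \<open>e\<close> is deleted along with the only child edge of \<open>q\<close>.\<close>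
        case True
        then obtain q where q: "e = {p, q}" "q \<noteq> p" using e(2) by (auto simp: card_2_iff)
        obtain u where u: "K q = {u}" using 2[of q] q by (auto simp: card_1_singleton_iff)
        then have uK: "u \<in> K q" by simp
        have "length [B0, B1] \<le> size M" using size_M card_V_ge[of "[p, q]"] q e_V by simp
        then obtain N where N: "M = N + mset [B0, B1]" "balanced N" using balanced_take[OF full_z2 balanced_M] by blast
        show ?thesis
        proof (rule reduce_remove[where us = "[u]" and rs = "[q]" and p = p and a = par, OF e _ _ _ _ N _ full_z2])
          fix g :: "'a \<Rightarrow> z2"
          obtain s x where x: "{#x, s#} = {#B0, B1#}" "{#?c u + s + x, (c e + g p) + s#} = {#B0, B1#}"
            using game_two_chain by blast
          then show "\<exists>x. mset (map x ([u] @ [q])) = mset [B0, B1] \<and>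
             mset (map (\<lambda>u. ?c u + (if par u \<in> set [q] then x (par u) else g (par u)) + x u) [u] @
             [c e + g p + sum_list (map x [q])]) = mset [B0, B1]"
            using K_D(2,6)[OF uK] by (intro exI[of _ "(\<lambda>_. B0)(u := x, q := s)"]) auto
        next
          fix v x
          assume "v \<in> set [q]" "x \<in> E" "v \<in> x"
          then show "x = e \<or> x \<in> pedge par ` set [u]" using K_only[of q x "{u}"] q u by auto
        qed (use K_D[OF uK] q in auto)
      next
        \<comment> \<open>\<open>q1\<close> and \<open>q2\<close> supply one child edge each;
          \<open>e\<close> stays, but loses \<open>q1\<close>.\<close>
        case False
        then have "2 \<le> card (e - {p})" using e_V e(2) by simp
        then obtain q1 q2 where q: "q1 \<in> e - {p}" "q2 \<in> e - {p}" "q1 \<noteq> q2"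
          using e_V by (metis card_le_Suc0_iff_eq finite_Diff not_less_eq_eq numeral_2_eq_2)
        obtain u1 u2 where u: "K q1 = {u1}" "K q2 = {u2}" using 2 q by (metis card_1_singleton_iff One_nat_def)
        then have uK: "u1 \<in> K q1" "u2 \<in> K q2" by auto
        have u12: "u1 \<noteq> u2" using K_disjoint uK q by blast
        have dist: "distinct [u1, u2, q1, q2]" using u12 q K_D(4)[OF uK(1)] K_D(4)[OF uK(2)] by auto
        have "set [p, q1, q2] \<subseteq> V" using q e_V e(2) by auto
        then have "length [B0, B1] < size M" using size_M card_V_ge[of "[p, q1, q2]"] q by auto
        then obtain N b where N: "M = N + mset ([B0, B1] @ [b])" "balanced N"
          using balanced_take_one[OF full_z2 balanced_M] by blast
        show ?thesis
        proof (rule reduce_keep[where us = "[u1, u2]" and rs = "[q1]" and ks = "[]" and a = par and \<kappa> = "b + B1",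
              OF e(1) _ _ _ _ _ _ N _ full_z2])
          fix g :: "'a \<Rightarrow> z2" and y
          obtain s x1 x2 where x: "{#x1, x2, s#} = {#B0, B1, b#}" "{#?c u1 + s + x1, (?c u2 + g q2) + x2, y - (b + B1) + s#} = {#y, B0, B1#}"
            using game_two_fork by blast
          then show "\<exists>x. mset (map x ([u1, u2] @ [q1] @ [])) = mset (map g [] @ [B0, B1] @ [b]) \<and>
            mset (map (\<lambda>u. ?c u + (if par u \<in> set ([q1] @ []) then x (par u) else g (par u)) + x u) [u1, u2] @
            [y - (b + B1) + sum_list (map x ([q1] @ [])) - sum_list (map g [])]) = mset (y # [B0, B1])"
            using K_D(2)[OF uK(1)] K_D(2)[OF uK(2)] dist
            by (intro exI[of _ "(\<lambda>_. B0)(u1 := x1, u2 := x2, q1 := s)"]) auto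
        next
          fix v x
          assume "v \<in> set ([q1] @ [])" "x \<in> E" "v \<in> x"
          then show "x = e \<or> x \<in> pedge par ` set [u1, u2]" using K_only[of q1 x "{u1, u2}"] q u by auto
        qed (use uK q dist K_D[OF uK(1)] K_D[OF uK(2)] e_V False in auto)
      qed
    qed
  qed
qed

section \<open>The induction step modulo 3\<close>

lemma full_z3: "mset [Z0, Z1, Z2] = repeat_mset 1 (mset_set UNIV)"
  by (simp add: mset_UNIV_z3)

lemma full2_z3: "mset [Z0, Z1, Z2, Z0, Z1, Z2] = repeat_mset 2 (mset_set UNIV)"
  by (simp add: mset_UNIV_z3 numeral_2_eq_2)

text \<open>A full set is taken out, and a label that may be added to the rest is put back. The two
  labels left over are distinct.\<close>

lemma balanced_take_two_z3:
  fixes M :: "z3 multiset"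
  assumes "balanced M" "3 \<le> size M"
  obtains N a b where "M = N + mset [a, b]" "balanced N" "a \<noteq> b"
proof -
  obtain N where N: "M = N + mset [Z0, Z1, Z2]" "balanced N" using balanced_take[OF full_z3 assms(1)] assms(2) by auto
  obtain d where d: "balanced (add_mset d N)" using balanced_add[OF N(2)] by blast
  have "\<exists>a b. mset [Z0, Z1, Z2] = mset [d, a, b] \<and> a \<noteq> b"
  proof (cases d)
    case Z0
    then show ?thesis by (intro exI[of _ Z1] exI[of _ Z2]) simp
  next
    case Z1
    then show ?thesis by (intro exI[of _ Z0] exI[of _ Z2]) simp
  next
    case Z2
    then show ?thesis by (intro exI[of _ Z0] exI[of _ Z1]) simp
  qed
  then obtain a b where ab: "mset [Z0, Z1, Z2] = mset [d, a, b]" "a \<noteq> b" by blast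
  have "M = add_mset d N + mset [a, b]" using N(1) unfolding ab(1) by simp
  then show thesis using that d ab(2) by blast
qed

text \<open>If both orders gave equal labels, then \<open>b - a = d1 - d2 = a - b\<close>, which
  modulo 3 implies \<open>a = b\<close>.\<close>

lemma game_three_swap:
  fixes a b :: z3
  assumes "a \<noteq> b"
  shows "\<exists>x1 x2. {#x1, x2#} = {#a, b#} \<and> d1 + x1 \<noteq> d2 + x2"
proof (cases "d1 + a = d2 + b")
  case True
  have "d1 + b \<noteq> d2 + a" using True assms by (cases a; cases b; cases d1; cases d2; simp)
  then show ?thesis by (intro exI[of _ b] exI[of _ a]) simp
qed auto

lemma solvable_step_z3:
  fixes c :: "'a set \<Rightarrow> z3"
  assumes "reduction_step V E M"
  shows "solvable V E c M"
proof -
  interpret reduction_step V E c M by (rule assms)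
  let ?c = "\<lambda>u. c (pedge par u)"
  consider "E = {}" | "E \<noteq> {}" "card E - 1 = 0" | "2 \<le> card E" by linarith
  then show ?thesis
  proof cases
    case 1
    then show ?thesis by (rule solvable_no_edges)
  next
    case 2
    then show ?thesis using solvable_one_more by simp
  next
    case 3
    then obtain e p s r where b: "bottom_step V E M e p s r" by (rule bottom_exists)
    interpret bottom_step V E c M e p s r by (rule b)
    have three: "3 \<le> size M" if "distinct [v1, v2, v3]" "v1 \<in> V" "v2 \<in> V" "v3 \<in> V" for v1 v2 v3
      using that card_V_ge[of "[v1, v2, v3]"] size_M by simp
    have q_V: "q \<in> V" if "q \<in> e - {p}" for q using that e_V by auto
    have p_V: "p \<in> V" using e e_V by auto
    have "e - {p} \<noteq> {}" using e_V e(2) by (metis Diff_eq_empty_iff One_nat_def card.empty card_insert_disjoint card_mono empty_iff finite.emptyI finite.insertI not_less_eq_eq numeral_2_eq_2 order_trans)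
    then obtain q where q: "q \<in> e - {p}" by blast
    then obtain u where u: "u \<in> K q" using K_nonempty by blast
    consider "card E = 2" | "3 \<le> card E" using 3 by linarith
    then show ?thesis
    proof cases
      case 1
      \<comment> \<open>Two edges cannot carry all three labels, but it is enough that their labels
        differ. Both leaves \<open>u\<close> and \<open>r\<close> are deleted, with two distinct
        labels to hand out.\<close>
      have "u \<noteq> r \<and> q \<noteq> r \<and> s \<noteq> u"
      proof (cases "p = r")
        case True
        then have "e = {s, r}" using e sr by (auto simp: pendant_def)
        then show ?thesis using K_D(4)[OF u] q True by auto
      next
        case False
        then show ?thesis using ext_D[OF False] q u by auto
      qed
      then have ur: "u \<noteq> r" and qr: "q \<noteq> r" and su: "s \<noteq> u" by auto
      have sr': "s \<noteq> r" "par r = s" using sr par_eq by (auto simp: pendant_def)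
      have "3 \<le> size M" using three[of p q u] q_V[OF q] p_V K_D[OF u] q e by auto
      then obtain N a b where N: "M = N + mset [a, b]" "balanced N" "a \<noteq> b" using balanced_take_two_z3[OF balanced_M] by blast
      show ?thesis
      proof (rule reduce_pendants[where us = "[u, r]" and a = par, OF _ _ _ _ N(1,2)])
        fix g :: "'a \<Rightarrow> z3"
        obtain x1 x2 where x: "{#x1, x2#} = {#a, b#}" "(?c u + g q) + x1 \<noteq> (?c r + g s) + x2"
          using game_three_swap[OF N(3)] by blast
        have "balanced {#(?c u + g q) + x1, (?c r + g s) + x2#}" using x(2) by (simp add: balanced_def)
        then show "\<exists>x. mset (map x [u, r]) = mset [a, b] \<and> balanced (mset (map (\<lambda>u. ?c u + g (par u) + x u) [u, r]))"
          using x(1) ur sr' K_D(2)[OF u] by (intro exI[of _ "(\<lambda>_. Z0)(u := x1, r := x2)"]) auto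
      qed (use 1 ur qr su sr sr' K_D[OF u] in auto)
    next
      case 2
      consider q where "q \<in> e - {p}" "3 \<le> card (K q)" | "\<And>q. q \<in> e - {p} \<Longrightarrow> card (K q) = 1 \<or> card (K q) = 2"
      proof (cases "\<exists>q\<in>e - {p}. 3 \<le> card (K q)")
        case False
        have "card (K q) = 1 \<or> card (K q) = 2" if "q \<in> e - {p}" for q
        proof -
          have "card (K q) \<noteq> 0" using K_nonempty[OF that] finite_K by simp
          moreover have "card (K q) < 3" using False that by force
          ultimately show ?thesis by linarith
        qed
        then show ?thesis using that by blast
      qed (use that in blast)
      then show ?thesis
      proof cases
        case (1 q)
        then obtain S where "S \<subseteq> K q" "card S = 3" using obtain_subset_with_card_n by metis
        then obtain u1 u2 u3 where u: "u1 \<in> K q" "u2 \<in> K q" "u3 \<in> K q" and dist: "distinct [u1, u2, u3]"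
          by (auto simp: card_3_iff)
        have par: "par u1 = q" "par u2 = q" "par u3 = q" using u K_D(2) by auto
        have "length [Z0, Z1, Z2] \<le> size M" using three[OF dist] u K_D(5) by auto
        then obtain N where N: "M = N + mset [Z0, Z1, Z2]" "balanced N" using balanced_take[OF full_z3 balanced_M] by blast
        show ?thesis
        proof (rule reduce_keep[where us = "[u1, u2, u3]" and rs = "[]" and ks = "[]" and a = par and \<kappa> = "?c u1 + ?c u2 + ?c u3",
            OF e(1) _ _ _ _ _ _ N _ full_z3])
          fix g :: "'a \<Rightarrow> z3" and y
          have eq: "(?c u1 + g q) + (?c u2 + g q) + (?c u3 + g q) = ?c u1 + ?c u2 + ?c u3"
            using z3_triple[of "g q"] by (metis (no_types, lifting) add.assoc add.commute add.right_neutral)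
          obtain x1 x2 x3 where x: "{#x1, x2, x3#} = {#Z0, Z1, Z2#}"
            "{#(?c u1 + g q) + x1, (?c u2 + g q) + x2, (?c u3 + g q) + x3, y - ((?c u1 + g q) + (?c u2 + g q) + (?c u3 + g q))#} = {#y, Z0, Z1, Z2#}"
            using game_three_same by blast
          show "\<exists>x. mset (map x ([u1, u2, u3] @ [] @ [])) = mset (map g [] @ [Z0, Z1, Z2]) \<and>
            mset (map (\<lambda>u. ?c u + (if par u \<in> set ([] @ []) then x (par u) else g (par u)) + x u) [u1, u2, u3] @
            [y - (?c u1 + ?c u2 + ?c u3) + sum_list (map x ([] @ [])) - sum_list (map g [])]) = mset (y # [Z0, Z1, Z2])"
            using x(1) x(2)[unfolded eq] dist par
            by (intro exI[of _ "(\<lambda>_. Z0)(u1 := x1, u2 := x2, u3 := x3)"]) auto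
        qed (use dist 1 K_D[OF u(1)] K_D[OF u(2)] K_D[OF u(3)] in auto)
      next
        case small: 2
        show ?thesis
        proof (cases "card e = 2")
          case True
          then have eq: "e = {p, q}" "q \<noteq> p" using e(2) q by (auto simp: card_2_iff)
          from small[OF q] show ?thesis
          proof
            assume "card (K q) = 2"
            then obtain u1 u2 where u: "K q = {u1, u2}" "u1 \<noteq> u2" by (auto simp: card_2_iff)
            then have uK: "u1 \<in> K q" "u2 \<in> K q" by auto
            have dist: "distinct [u1, u2, q]" using u K_D(4)[OF uK(1)] K_D(4)[OF uK(2)] q by auto
            have "length [Z0, Z1, Z2] \<le> size M" using three[OF dist] q_V[OF q] uK K_D(5) by auto
            then obtain N where N: "M = N + mset [Z0, Z1, Z2]" "balanced N" using balanced_take[OF full_z3 balanced_M] by blast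
            show ?thesis
            proof (rule reduce_remove[where us = "[u1, u2]" and rs = "[q]" and p = p and a = par, OF e _ _ _ _ N _ full_z3])
              fix g :: "'a \<Rightarrow> z3"
              obtain s x1 x2 where x: "{#x1, x2, s#} = {#Z0, Z1, Z2#}" "{#?c u1 + s + x1, ?c u2 + s + x2, (c e + g p) + s#} = {#Z0, Z1, Z2#}"
                using game_three_cherry by blast
              then show "\<exists>x. mset (map x ([u1, u2] @ [q])) = mset [Z0, Z1, Z2] \<and>
                mset (map (\<lambda>u. ?c u + (if par u \<in> set [q] then x (par u) else g (par u)) + x u) [u1, u2] @
                [c e + g p + sum_list (map x [q])]) = mset [Z0, Z1, Z2]"
                using K_D(2)[OF uK(1)] K_D(2)[OF uK(2)] dist
                by (intro exI[of _ "(\<lambda>_. Z0)(u1 := x1, u2 := x2, q := s)"]) auto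
            next
              fix v x
              assume "v \<in> set [q]" "x \<in> E" "v \<in> x"
              then show "x = e \<or> x \<in> pedge par ` set [u1, u2]" using K_only[of q x "{u1, u2}"] q u by auto
            qed (use dist eq K_D[OF uK(1)] K_D[OF uK(2)] in auto)
          next
            assume "card (K q) = 1"
            then obtain u where u: "K q = {u}" by (auto simp: card_1_singleton_iff)
            then have uK: "u \<in> K q" by simp
            \<comment> \<open>The child edge and \<open>e\<close> are only two of the three edges to
              be deleted; the third is that of \<open>r\<close>. For \<open>p = r\<close> all edges
              would contain \<open>q\<close>, so there would be just these two, against
              \<open>3 \<le> card E\<close>.\<close>
            have pr: "p \<noteq> r"
            proof
              assume "p = r"
              then have "\<forall>x\<in>E. q \<in> x" using root eq by (auto simp: doubleton_eq_iff)
              then have "E \<subseteq> {e, pedge par u}" using K_only[OF q, of _ "{u}"] u by auto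
              then have "card E \<le> card {e, pedge par u}" by (rule card_mono[rotated]) simp
              also have "\<dots> \<le> 2" by (simp add: card_insert_if)
              finally show False using 2 by simp
            qed
            note ex = ext_D[OF pr]
            have dist: "distinct [u, r, q]" using uK K_D(4)[OF uK] q ex by auto
            have s: "s \<noteq> q" "s \<noteq> u" "s \<noteq> r" using ext(1)[OF pr] q ex(5) ex(7)[OF uK q] by auto
            have "length [Z0, Z1, Z2] \<le> size M" using three[OF dist] q_V[OF q] uK K_D(5) ex(4) by auto
            then obtain N where N: "M = N + mset [Z0, Z1, Z2]" "balanced N" using balanced_take[OF full_z3 balanced_M] by blast
            show ?thesis
            proof (rule reduce_remove[where us = "[u, r]" and rs = "[q]" and p = p and a = par, OF e _ _ _ _ N _ full_z3])
              fix g :: "'a \<Rightarrow> z3"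
              obtain t x1 x2 where x: "{#x1, x2, t#} = {#Z0, Z1, Z2#}" "{#?c u + t + x1, (?c r + g s) + x2, (c e + g p) + t#} = {#Z0, Z1, Z2#}"
                using game_three_chain by blast
              then show "\<exists>x. mset (map x ([u, r] @ [q])) = mset [Z0, Z1, Z2] \<and>
                mset (map (\<lambda>u. ?c u + (if par u \<in> set [q] then x (par u) else g (par u)) + x u) [u, r] @
                [c e + g p + sum_list (map x [q])]) = mset [Z0, Z1, Z2]"
                using K_D(2)[OF uK] ex(1) dist s
                by (intro exI[of _ "(\<lambda>_. Z0)(u := x1, r := x2, q := t)"]) auto
            next
              fix v x
              assume "v \<in> set [q]" "x \<in> E" "v \<in> x"
              then show "x = e \<or> x \<in> pedge par ` set [u, r]" using K_only[of q x "{u, r}"] q u by auto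
            qed (use dist s eq sr ex(1,2) K_D[OF uK] in auto)
          qed
        next
          case False
          then have card_e: "3 \<le> card e" using e_V by simp
          have pr: "p \<noteq> r"
          proof
            assume "p = r"
            then obtain v where "e = {p, v}" using root by blast
            then show False using card_e by (simp add: card_insert_if split: if_splits)
          qed
          note ex = ext_D[OF pr]
          \<comment> \<open>One child of \<open>q1\<close> and two of \<open>q2\<close> make up the
            three edges. \<open>q1\<close> is deleted, while \<open>q2\<close> stays in
            \<open>e\<close> and returns its label \<open>g q2\<close> to the labels being handed
            out. The claim is general in \<open>q1\<close>, \<open>q2\<close> because it is applied
            in either order, and later with a third vertex of \<open>e\<close>.\<close>
          have fork: ?thesis if q: "q1 \<in> e - {p}" "q2 \<in> e - {p}" and cards: "card (K q1) = 1" "card (K q2) = 2" for q1 q2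
          proof -
            obtain u1 where u1: "K q1 = {u1}" using cards by (auto simp: card_1_singleton_iff)
            obtain u2 u3 where u2: "K q2 = {u2, u3}" "u2 \<noteq> u3" using cards by (auto simp: card_2_iff)
            have uK: "u1 \<in> K q1" "u2 \<in> K q2" "u3 \<in> K q2" using u1 u2 by auto
            have q12: "q1 \<noteq> q2" using cards by auto
            have dist: "distinct [u1, u2, u3, q1, q2]"
              using u2(2) q12 q K_disjoint[of u1 q1 q2] uK K_D(4)[OF uK(1)] K_D(4)[OF uK(2)] K_D(4)[OF uK(3)] by auto
            have "set [u1, u2, u3, q1, q2] \<subseteq> V" using q_V q uK K_D(5) by auto
            then have "length [Z0, Z1, Z2] < size M" using size_M card_V_ge[OF dist] by simp
            then obtain N b where N: "M = N + mset ([Z0, Z1, Z2] @ [b])" "balanced N"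
              using balanced_take_one[OF full_z3 balanced_M] by blast
            show ?thesis
            proof (rule reduce_keep[where us = "[u1, u2, u3]" and rs = "[q1]" and ks = "[q2]" and a = par and \<kappa> = "b - Z1",
                  OF e(1) _ _ _ _ _ _ N _ full_z3])
              fix g :: "'a \<Rightarrow> z3" and y
              obtain s t x1 x2 x3 where x: "{#x1, x2, x3, s, t#} = {#g q2, Z0, Z1, Z2, b#}"
                "{#?c u1 + s + x1, ?c u2 + t + x2, ?c u3 + t + x3, y - (b - Z1) + (s + t) - g q2#} = {#y, Z0, Z1, Z2#}"
                using game_three_fork by blast
              then show "\<exists>x. mset (map x ([u1, u2, u3] @ [q1] @ [q2])) = mset (map g [q2] @ [Z0, Z1, Z2] @ [b]) \<and>
                mset (map (\<lambda>u. ?c u + (if par u \<in> set ([q1] @ [q2]) then x (par u) else g (par u)) + x u) [u1, u2, u3] @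
                [y - (b - Z1) + sum_list (map x ([q1] @ [q2])) - sum_list (map g [q2])]) = mset (y # [Z0, Z1, Z2])"
                using K_D(2)[OF uK(1)] K_D(2)[OF uK(2)] K_D(2)[OF uK(3)] dist
                by (intro exI[of _ "(\<lambda>_. Z0)(u1 := x1, u2 := x2, u3 := x3, q1 := s, q2 := t)"]) auto
            next
              fix v x
              assume "v \<in> set ([q1] @ [q2])" "x \<in> E" "v \<in> x"
              then show "x = e \<or> x \<in> pedge par ` set [u1, u2, u3]"
                using K_only[of q1 x "{u1, u2, u3}"] K_only[of q2 x "{u1, u2, u3}"] q u1 u2 by auto
            qed (use q dist card_e K_D[OF uK(1)] K_D[OF uK(2)] K_D[OF uK(3)] in auto)
          qed
          have "2 \<le> card (e - {p})" using card_e e_V e(2) by simp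
          then obtain q1 q2 where q: "q1 \<in> e - {p}" "q2 \<in> e - {p}" "q1 \<noteq> q2"
            using e_V by (metis card_le_Suc0_iff_eq finite_Diff not_less_eq_eq numeral_2_eq_2)
          consider "card (K q1) = 1" "card (K q2) = 1" | "card (K q1) = 1" "card (K q2) = 2"
            | "card (K q2) = 1" "card (K q1) = 2" | "card (K q1) = 2" "card (K q2) = 2"
            using small q by metis
          then show ?thesis
          proof cases
            case 1
            obtain u1 where u1: "K q1 = {u1}" using 1 by (auto simp: card_1_singleton_iff)
            obtain u2 where u2: "K q2 = {u2}" using 1 by (auto simp: card_1_singleton_iff)
            have uK: "u1 \<in> K q1" "u2 \<in> K q2" using u1 u2 by auto
            have dist: "distinct [u1, u2, r, q1, q2]"
              using q K_disjoint[of u1 q1 q2] uK K_D(4)[OF uK(1)] K_D(4)[OF uK(2)] ex(3,6) by auto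
            have s: "s \<noteq> u1" "s \<noteq> u2" "s \<noteq> r" "s \<noteq> q1" "s \<noteq> q2"
              using ext(1)[OF pr] q ex(5) ex(7)[OF uK(1) q(1)] ex(7)[OF uK(2) q(2)] by auto
            have "set [u1, u2, r, q1, q2] \<subseteq> V" using q_V q uK K_D(5) ex(4) by auto
            then have "length [Z0, Z1, Z2] < size M" using size_M card_V_ge[OF dist] by simp
            then obtain N b where N: "M = N + mset ([Z0, Z1, Z2] @ [b])" "balanced N"
              using balanced_take_one[OF full_z3 balanced_M] by blast
            show ?thesis
            proof (rule reduce_keep[where us = "[u1, u2, r]" and rs = "[q1]" and ks = "[q2]" and a = par and \<kappa> = b,
                  OF e(1) _ _ _ _ _ _ N _ full_z3])
              fix g :: "'a \<Rightarrow> z3" and y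
              obtain s' t x1 x2 x3 where x: "{#x1, x2, x3, s', t#} = {#g q2, Z0, Z1, Z2, b#}"
                "{#?c u1 + s' + x1, ?c u2 + t + x2, (?c r + g s) + x3, y - b + (s' + t) - g q2#} = {#y, Z0, Z1, Z2#}"
                using game_three_fork_ext by blast
              then show "\<exists>x. mset (map x ([u1, u2, r] @ [q1] @ [q2])) = mset (map g [q2] @ [Z0, Z1, Z2] @ [b]) \<and>
                mset (map (\<lambda>u. ?c u + (if par u \<in> set ([q1] @ [q2]) then x (par u) else g (par u)) + x u) [u1, u2, r] @
                [y - b + sum_list (map x ([q1] @ [q2])) - sum_list (map g [q2])]) = mset (y # [Z0, Z1, Z2])"
                using K_D(2)[OF uK(1)] K_D(2)[OF uK(2)] ex(1) dist s
                by (intro exI[of _ "(\<lambda>_. Z0)(u1 := x1, u2 := x2, r := x3, q1 := s', q2 := t)"]) auto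
            next
              fix v x
              assume "v \<in> set ([q1] @ [q2])" "x \<in> E" "v \<in> x"
              then show "x = e \<or> x \<in> pedge par ` set [u1, u2, r]"
                using K_only[of q1 x "{u1, u2, r}"] K_only[of q2 x "{u1, u2, r}"] q u1 u2 by auto
            qed (use q s sr ex(1,2) dist card_e K_D[OF uK(1)] K_D[OF uK(2)] in auto)
          next
            case 2
            then show ?thesis using fork q by blast
          next
            case 3
            then show ?thesis using fork q by blast
          next
            case 4
            obtain u1 u2 where u1: "K q1 = {u1, u2}" "u1 \<noteq> u2" using 4 by (auto simp: card_2_iff)
            obtain u3 u4 where u3: "K q2 = {u3, u4}" "u3 \<noteq> u4" using 4 by (auto simp: card_2_iff)
            have uK: "u1 \<in> K q1" "u2 \<in> K q1" "u3 \<in> K q2" "u4 \<in> K q2" using u1 u3 by auto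
            note D = K_D[OF uK(1)] K_D[OF uK(2)] K_D[OF uK(3)] K_D[OF uK(4)]
            have dist4: "distinct [u1, u2, u3, u4, q1, q2]"
              using u1(2) u3(2) q D K_disjoint[of _ q1 q2] uK by auto
            \<comment> \<open>Four child edges need two more. If \<open>e\<close> has no further
              vertex, \<open>e\<close> itself and the edge of \<open>r\<close> are added.\<close>
            show ?thesis
            proof (cases "card e = 3")
              case True
              have "card {p, q1, q2} = 3" using q by auto
              then have e_eq: "e = {p, q1, q2}" using card_subset_eq[of e "{p, q1, q2}"] q e True e_V by auto
              have dist: "distinct [u1, u2, u3, u4, r, q1, q2]" using dist4 ex(3) ex(6)[OF q(1)] ex(6)[OF q(2)] uK q by auto
              have s: "s \<notin> set [u1, u2, u3, u4, r, q1, q2]"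
                using ext(1)[OF pr] q ex(5) ex(7)[OF uK(1) q(1)] ex(7)[OF uK(2) q(1)] ex(7)[OF uK(3) q(2)] ex(7)[OF uK(4) q(2)] by auto
              have "set [u1, u2, u3, u4, r, q1, q2] \<subseteq> V" using q_V q D ex(4) by auto
              then have "length [Z0, Z1, Z2, Z0, Z1, Z2] < size M" using size_M card_V_ge[OF dist] by simp
              then obtain N b where N: "M = N + mset ([Z0, Z1, Z2, Z0, Z1, Z2] @ [b])" "balanced N"
                using balanced_take_one[OF full2_z3 balanced_M] by blast
              show ?thesis
              proof (rule reduce_remove[where us = "[u1, u2, u3, u4, r]" and rs = "[q1, q2]" and p = p and a = par, OF e _ _ _ _ N _ full2_z3])
                fix g :: "'a \<Rightarrow> z3"
                obtain s' t x1 x2 x3 x4 x5 where x: "{#x1, x2, x3, x4, x5, s', t#} = {#Z0, Z1, Z2, Z0, Z1, Z2, b#}"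
                  "{#?c u1 + s' + x1, ?c u2 + s' + x2, ?c u3 + t + x3, ?c u4 + t + x4, (?c r + g s) + x5, (c e + g p) + (s' + t)#} =
                    {#Z0, Z1, Z2, Z0, Z1, Z2#}"
                  using game_three_two_cherries[where b = b and ?c1.0 = "?c u1" and ?c2.0 = "?c u2" and ?c3.0 = "?c u3"
                      and ?c4.0 = "?c u4" and g = "?c r + g s" and h = "c e + g p"] by blast
                then show "\<exists>x. mset (map x ([u1, u2, u3, u4, r] @ [q1, q2])) = mset ([Z0, Z1, Z2, Z0, Z1, Z2] @ [b]) \<and>
                  mset (map (\<lambda>u. ?c u + (if par u \<in> set [q1, q2] then x (par u) else g (par u)) + x u) [u1, u2, u3, u4, r] @
                  [c e + g p + sum_list (map x [q1, q2])]) = mset [Z0, Z1, Z2, Z0, Z1, Z2]"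
                  using D(2,8,14,20) ex(1) dist s
                  by (intro exI[of _ "(\<lambda>_. Z0)(u1 := x1, u2 := x2, u3 := x3, u4 := x4, r := x5, q1 := s', q2 := t)"]) auto
              next
                fix v x
                assume v: "v \<in> set [q1, q2]" and x: "x \<in> E" "v \<in> x"
                have "K q1 \<subseteq> set [u1, u2, u3, u4, r]" "K q2 \<subseteq> set [u1, u2, u3, u4, r]" using u1 u3 by auto
                moreover have "v = q1 \<or> v = q2" using v by simp
                ultimately show "x = e \<or> x \<in> pedge par ` set [u1, u2, u3, u4, r]" using K_only[OF q(1) x(1)] K_only[OF q(2) x(1)] x(2) by blast
              next
                fix v
                assume "v \<in> set [u1, u2, u3, u4, r]"
                then have "v = u1 \<or> v = u2 \<or> v = u3 \<or> v = u4 \<or> v = r" by simp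
                then show "pendant E (par v) v \<and> par v \<notin> set [u1, u2, u3, u4, r] \<and> pedge par v \<noteq> e"
                  using D(1-3,7-9,13-15,19-21) sr ex(1,2) dist s by (elim disjE) auto
              next
                show "set [q1, q2] = e - {p}" using e_eq q by auto
              qed (use dist in simp_all)
            next
              \<comment> \<open>A further vertex \<open>q3\<close> either has a single child, so
                that \<open>fork\<close> applies, or provides the two missing child edges. In the
                latter case \<open>e\<close> stays and \<open>q3\<close> keeps its label, whatever
                it is.\<close>
              case False
              have "card (e - {p} - {q1} - {q2}) \<noteq> 0" using card_e False e_V e(2) q by simp
              then obtain q3 where q3: "q3 \<in> e - {p}" "q3 \<noteq> q1" "q3 \<noteq> q2" by (metis DiffE card.empty equals0I singletonI)
              show ?thesis
              proof (cases "card (K q3) = 1")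
                case True
                then show ?thesis using fork q q3 4 by blast
              next
                case False
                then have "card (K q3) = 2" using small q3 by blast
                then obtain u5 u6 where u5: "K q3 = {u5, u6}" "u5 \<noteq> u6" by (auto simp: card_2_iff)
                have uK3: "u5 \<in> K q3" "u6 \<in> K q3" using u5 by auto
                note D3 = K_D[OF uK3(1)] K_D[OF uK3(2)]
                have dist: "distinct [u1, u2, u3, u4, u5, u6, q1, q2]"
                  using dist4 u5(2) q q3 D3 K_disjoint[of _ q1 q3] K_disjoint[of _ q2 q3] uK uK3 by auto
                have "set [u1, u2, u3, u4, u5, u6, q1, q2] \<subseteq> V" using q_V q D D3 by auto
                then have "length [Z0, Z1, Z2, Z0, Z1, Z2] < size M" using size_M card_V_ge[OF dist] by simp
                then obtain N b where N: "M = N + mset ([Z0, Z1, Z2, Z0, Z1, Z2] @ [b])" "balanced N"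
                  using balanced_take_one[OF full2_z3 balanced_M] by blast
                have q3_not: "q3 \<notin> set [u1, u2, u3, u4, u5, u6]" using q3 D D3 by auto
                show ?thesis
                proof (rule reduce_keep[where us = "[u1, u2, u3, u4, u5, u6]" and rs = "[q1]" and ks = "[q2]" and a = par and \<kappa> = 0,
                      OF e(1) _ _ _ _ _ _ N _ full2_z3])
                  fix g :: "'a \<Rightarrow> z3" and y
                  obtain s' t x1 x2 x3 x4 x5 x6 where x: "{#x1, x2, x3, x4, x5, x6, s', t#} = {#g q2, Z0, Z1, Z2, Z0, Z1, Z2, b#}"
                    "{#?c u1 + s' + x1, ?c u2 + s' + x2, ?c u3 + t + x3, ?c u4 + t + x4, (?c u5 + g q3) + x5, (?c u6 + g q3) + x6,
                      y + (s' + t) - g q2#} = {#y, Z0, Z1, Z2, Z0, Z1, Z2#}"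
                    using game_three_three_cherries[where b = b and \<psi> = "g q2" and ?c1.0 = "?c u1" and ?c2.0 = "?c u2" and ?c3.0 = "?c u3"
                      and ?c4.0 = "?c u4" and ?d1.0 = "?c u5 + g q3" and ?d2.0 = "?c u6 + g q3" and y = y] by blast
                  then show "\<exists>x. mset (map x ([u1, u2, u3, u4, u5, u6] @ [q1] @ [q2])) = mset (map g [q2] @ [Z0, Z1, Z2, Z0, Z1, Z2] @ [b]) \<and>
                    mset (map (\<lambda>u. ?c u + (if par u \<in> set ([q1] @ [q2]) then x (par u) else g (par u)) + x u) [u1, u2, u3, u4, u5, u6] @
                    [y - 0 + sum_list (map x ([q1] @ [q2])) - sum_list (map g [q2])]) = mset (y # [Z0, Z1, Z2, Z0, Z1, Z2])"
                    using D(2,8,14,20) D3(2,8) dist q3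
                    by (intro exI[of _ "(\<lambda>_. Z0)(u1 := x1, u2 := x2, u3 := x3, u4 := x4, u5 := x5, u6 := x6, q1 := s', q2 := t)"]) auto
                next
                  fix v x
                  assume v: "v \<in> set ([q1] @ [q2])" and x: "x \<in> E" "v \<in> x"
                  have "K q1 \<subseteq> set [u1, u2, u3, u4, u5, u6]" "K q2 \<subseteq> set [u1, u2, u3, u4, u5, u6]" using u1 u3 by auto
                  moreover have "v = q1 \<or> v = q2" using v by simp
                  ultimately show "x = e \<or> x \<in> pedge par ` set [u1, u2, u3, u4, u5, u6]" using K_only[OF q(1) x(1)] K_only[OF q(2) x(1)] x(2) by blast
                next
                  fix v
                  assume "v \<in> set [u1, u2, u3, u4, u5, u6]"
                  then have "v = u1 \<or> v = u2 \<or> v = u3 \<or> v = u4 \<or> v = u5 \<or> v = u6" by simp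
                  moreover have "q1 \<notin> set [u1, u2, u3, u4, u5, u6]" "q2 \<notin> set [u1, u2, u3, u4, u5, u6]" using dist by auto
                  ultimately show "pendant E (par v) v \<and> par v \<notin> set [u1, u2, u3, u4, u5, u6] \<and> pedge par v \<noteq> e"
                    using K_pend[OF uK(1)] K_pend[OF uK(2)] K_pend[OF uK(3)] K_pend[OF uK(4)]
                      K_pend[OF uK3(1) q3_not] K_pend[OF uK3(2) q3_not] by blast
                qed (use q dist card_e in auto)
              qed
            qed
          qed
        qed
      qed
    qed
  qed
qed

section \<open>Cordial labelings\<close>

lemma solvable_induct:
  fixes c :: "'a set \<Rightarrow> 'l::{ab_group_add,finite}"
  assumes step: "\<And>V E (c :: 'a set \<Rightarrow> 'l) M. reduction_step V E M \<Longrightarrow> solvable V E c M"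
    and "htree V E" "balanced M" "size M = card V"
  shows "solvable V E c M"
  using assms(2-)
proof (induction "card V" arbitrary: V E c M rule: less_induct)
  case less
  show ?case
  proof (cases "normalized E")
    case True
    show ?thesis
      by (rule step, rule reduction_step.intro[OF less.prems(1) True less.prems(2,3)]) (rule less.hyps)
  next
    case False
    show ?thesis by (rule solvable_normalize[OF less.prems False]) (rule less.hyps)
  qed
qed

lemma balanced_exists: "\<exists>M :: 'l::finite multiset. balanced M \<and> size M = n"
proof (induction n)
  case 0
  show ?case by (intro exI[of _ "{#}"]) (simp add: balanced_def)
next
  case (Suc n)
  then obtain M :: "'l multiset" where M: "balanced M" "size M = n" by blast
  obtain a where "balanced (add_mset a M)" using balanced_add[OF M(1)] by blast
  with M(2) show ?case by (intro exI[of _ "add_mset a M"]) simp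
qed

lemma count_image_mset_set: "finite A \<Longrightarrow> count (image_mset f (mset_set A)) b = card {x \<in> A. f x = b}"
proof -
  assume "finite A"
  moreover have "f -` {b} \<inter> A = {x \<in> A. f x = b}" by auto
  ultimately show ?thesis by (simp add: count_image_mset)
qed

lemma cordial_if_solvable:
  fixes h :: "'l::ab_group_add \<Rightarrow> nat"
  assumes h: "inj h" "range h = {..<k}" "h 0 = 0" "\<And>x y. h (x + y) = (h x + h y) mod k"
    and H: "hypergraph V E" and s: "solvable V E (\<lambda>_. 0 :: 'l) M" and M: "balanced M"
  shows "cordial k V E"
proof -
  obtain f where f: "image_mset f (mset_set V) = M" "balanced (image_mset (elabel (\<lambda>_. 0) f) (mset_set E))"
    using s by (auto simp: solvable_def)
  have V: "finite V" and "E \<subseteq> Pow V" using H by (auto simp: hypergraph_def)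
  then have E: "finite E" by (meson finite_Pow_iff finite_subset)
  have lab: "edge_label k (h \<circ> f) e = h (elabel (\<lambda>_. 0) f e)" if "e \<in> E" for e
  proof -
    have "finite e" using that \<open>E \<subseteq> Pow V\<close> V finite_subset by blast
    then have "(\<Sum>v\<in>e. h (f v)) mod k = h (sum f e)"
    proof induction
      case (insert v e)
      then show ?case using h(4) by (metis mod_add_right_eq sum.insert)
    qed (simp add: h(3))
    then show ?thesis by (simp add: edge_label_def elabel_def)
  qed
  have vc: "vertex_count V (h \<circ> f) (h a) = count M a" for a
    using h(1) count_image_mset_set[OF V, of f a] f(1) by (simp add: vertex_count_def inj_eq)
  have "{e \<in> E. edge_label k (h \<circ> f) e = h a} = {e \<in> E. elabel (\<lambda>_. 0) f e = a}" for a
    using lab h(1) by (auto simp: inj_eq)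
  then have ec: "edge_count k E (h \<circ> f) (h a) = count (image_mset (elabel (\<lambda>_. 0) f) (mset_set E)) a" for a
    using count_image_mset_set[OF E, of "elabel (\<lambda>_. 0) f" a] by (simp add: edge_count_def)
  have close: "\<bar>int m - int n\<bar> \<le> 1" if "m \<le> Suc n" "n \<le> Suc m" for m n
    using that by linarith
  have "cordial_labeling k V E (h \<circ> f)"
    unfolding cordial_labeling_def
  proof (intro conjI ballI allI impI)
    show "(h \<circ> f) v < k" for v using h(2) by auto
    fix a b assume ab: "a < k" "b < k"
    then obtain x y where "a = h x" "b = h y" using h(2) by (metis imageE lessThan_iff)
    then show "\<bar>int (vertex_count V (h \<circ> f) a) - int (vertex_count V (h \<circ> f) b)\<bar> \<le> 1"
      and "\<bar>int (edge_count k E (h \<circ> f) a) - int (edge_count k E (h \<circ> f) b)\<bar> \<le> 1"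
      using M f(2) unfolding balanced_def by (auto simp: vc ec intro!: close)
  qed
  then show ?thesis by (auto simp: cordial_def)
qed

fun nat_of_z2 :: "z2 \<Rightarrow> nat" where
  "nat_of_z2 B0 = 0" | "nat_of_z2 B1 = 1"

fun nat_of_z3 :: "z3 \<Rightarrow> nat" where
  "nat_of_z3 Z0 = 0" | "nat_of_z3 Z1 = 1" | "nat_of_z3 Z2 = 2"

theorem theorem1:
  fixes k :: nat and V :: "'a set" and E :: "'a set set"
  assumes "k \<in> {2, 3}" and "hypertree V E"
  shows "cordial k V E"
proof -
  have H: "htree V E" using assms(2) by (rule hypertree_imp_htree)
  then have hyp: "hypergraph V E" by (simp add: htree_def)
  show ?thesis
  proof (cases "k = 2")
    case True
    obtain M :: "z2 multiset" where M: "balanced M" "size M = card V" using balanced_exists by blast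
    have "solvable V E (\<lambda>_. 0) M" by (rule solvable_induct[OF solvable_step_z2 H M])
    then show ?thesis
    proof (rule cordial_if_solvable[where h = nat_of_z2, rotated -2])
      show "inj nat_of_z2" by (rule injI) (metis nat_of_z2.elims zero_neq_one)
      show "range nat_of_z2 = {..<k}" using True by (auto simp: UNIV_z2)
      show "nat_of_z2 (x + y) = (nat_of_z2 x + nat_of_z2 y) mod k" for x y
        using True by (cases x; cases y; simp)
    qed (use hyp M in \<open>simp_all add: zero_z2_def\<close>)
  next
    case False
    then have k: "k = 3" using assms(1) by simp
    obtain M :: "z3 multiset" where M: "balanced M" "size M = card V" using balanced_exists by blast
    have "solvable V E (\<lambda>_. 0) M" by (rule solvable_induct[OF solvable_step_z3 H M])
    then show ?thesis
    proof (rule cordial_if_solvable[where h = nat_of_z3, rotated -2])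
      show "inj nat_of_z3"
      proof (rule injI)
        fix x y assume "nat_of_z3 x = nat_of_z3 y"
        then show "x = y" by (cases x; cases y; simp)
      qed
      show "range nat_of_z3 = {..<k}" using k by (auto simp: UNIV_z3)
      show "nat_of_z3 (x + y) = (nat_of_z3 x + nat_of_z3 y) mod k" for x y
        using k by (cases x; cases y; simp)
    qed (use hyp M in \<open>simp_all add: zero_z3_def\<close>)
  qed
qed

end
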